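(* Let $(\mathfrak g,[\cdot,\cdot]_{\mathfrak g},\phi_{\mathfrak g})$ and $(\mathfrak h,[\cdot,\cdot]_{\mathfrak h},\phi_{\mathfrak h})$ be regular Hom-Lie algebras such that $\mathrm{Cen}(\mathfrak h)=0$. Suppose that the short exact sequence of Hom-Lie algebra morphisms $$0\to \mathrm{Inn}(\mathfrak h)\to \mathrm{Der}(\mathfrak h)\xrightarrow{\ \pi\ }\mathrm{Out}(\mathfrak h)\to 0$$ is a diagonal non-abelian extension of $\mathrm{Out}(\mathfrak h)$ by $\mathrm{Inn}(\mathfrak h)$. Then isomorphism classes of diagonal non-abelian extensions of $\mathfrak g$ by $\mathfrak h$ correspond bijectively to Hom-Lie algebra homomorphisms $\bar\rho:\mathfrak g\to \mathrm{Out}(\mathfrak h)$, where the class of an extension corresponds to the homomorphism $\bar\rho$ induced by that extension.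
   Context: All vector spaces are over an algebraically closed field $\mathbb K$ of characteristic $0$. Hom-Lie algebras. A (multiplicative) Hom-Lie algebra $(\mathfrak g,[\cdot,\cdot]_{\mathfrak g},\phi_{\mathfrak g})$ is a vector space $\mathfrak g$ with a skew-symmetric bilinear bracket and a linear map $\phi_{\mathfrak g}:\mathfrak g\to\mathfrak g$ preserving the bracket such that $[\phi_{\mathfrak g}(x),[y,z]_{\mathfrak g}]_{\mathfrak g}+[\phi_{\mathfrak g}(y),[z,x]_{\mathfrak g}]_{\mathfrak g}+[\phi_{\mathfrak g}(z),[x,y]_{\mathfrak g}]_{\mathfrak g}=0$. It is regular if $\phi_{\mathfrak g}$ is an algebra automorphism (in particular invertible). All Hom-Lie algebras here are assumed regular. A morphism (homomorphism) $f:\mathfrak g\to\mathfrak h$ of Hom-Lie algebras is a linear map with $f[x,y]_{\mathfrak g}=[f(x),f(y)]_{\mathfrak h}$ and $f\circ\phi_{\mathfrak g}=\phi_{\mathfrak h}\circ f$. The center is $\mathrm{Cen}(\mathfrak h)=\{u\in\mathfrak h: [u,v]_{\mathfrak h}=0\ \forall v\in\mathfrak h\}$. Derivations. For a vector space $V$ and $\beta\in GL(V)$, put $\mathrm{Ad}_\beta(A)=\beta A\beta^{-1}$ and $[A,B]_\beta=\beta A\beta^{-1}B\beta^{-1}-\beta B\beta^{-1}A\beta^{-1}$; then $(\mathfrak{gl}(V),[\cdot,\cdot]_\beta,\mathrm{Ad}_\beta)$ is a regular Hom-Lie algebra. A derivation of $\mathfrak h$ is a linear map $D:\mathfrak h\to\mathfrak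 h$ with $D[u,v]_{\mathfrak h}=[\phi_{\mathfrak h}(u),(\mathrm{Ad}_{\phi_{\mathfrak h}^{-1}}D)(v)]_{\mathfrak h}+[(\mathrm{Ad}_{\phi_{\mathfrak h}^{-1}}D)(u),\phi_{\mathfrak h}(v)]_{\mathfrak h}$ for all $u,v$. The set $\mathrm{Der}(\mathfrak h)$ of derivations is a Hom-Lie subalgebra of $(\mathfrak{gl}(\mathfrak h),[\cdot,\cdot]_{\phi_{\mathfrak h}},\mathrm{Ad}_{\phi_{\mathfrak h}})$. With $\mathrm{ad}_u(v)=[u,v]_{\mathfrak h}$, the set $\mathrm{Inn}(\mathfrak h)=\{\mathrm{ad}_u:u\in\mathfrak h\}$ is an ideal of $\mathrm{Der}(\mathfrak h)$; $\mathrm{Out}(\mathfrak h)=\mathrm{Der}(\mathfrak h)/\mathrm{Inn}(\mathfrak h)$ carries the induced Hom-Lie algebra structure and $\pi:\mathrm{Der}(\mathfrak h)\to\mathrm{Out}(\mathfrak h)$ is the quotient map. Extensions. A non-abelian extension of $\mathfrak g$ by $\mathfrak h$ is a short exact sequence of Hom-Lie algebra morphisms $0\to\mathfrak h\xrightarrow{\iota}\hat{\mathfrak g}\xrightarrow{p}\mathfrak g\to0$, with $\hat{\mathfrak g}$ a Hom-Lie algebra; $\mathfrak h$ is regarded as a subspace of $\hat{\mathfrak g}$. It is diagonal if $\hat{\mathfrak g}$ has a $\phi_{\hat{\mathfrak g}}$-invariant subspace $X$ with $\mathfrak h\oplus X=\hat{\mathfrak g}$; equivalently, there is a linear map $s:\mathfrak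 g\to\hat{\mathfrak g}$ with $p\circ s=\mathrm{Id}$ and $\phi_{\hat{\mathfrak g}}\circ s=s\circ\phi_{\mathfrak g}$ (a diagonal section). Two extensions $(\hat{\mathfrak g}_1,\iota_1,p_1)$ and $(\hat{\mathfrak g}_2,\iota_2,p_2)$ of $\mathfrak g$ by $\mathfrak h$ are isomorphic if there is a Hom-Lie algebra morphism $\theta:\hat{\mathfrak g}_2\to\hat{\mathfrak g}_1$ with $\theta\circ\iota_2=\iota_1$ and $p_1\circ\theta=p_2$. Induced homomorphism. Given a diagonal extension $\hat{\mathfrak g}$ and a diagonal section $s$, the maps $\rho_x(u)=[s(x),u]_{\hat{\mathfrak g}}$ ($x\in\mathfrak g$, $u\in\mathfrak h$) are derivations of $\mathfrak h$, and the homomorphism induced by the extension is $\bar\rho=\pi\circ\rho:\mathfrak g\to\mathrm{Out}(\mathfrak h)$; it does not depend on the choice of $s$. *)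

theory Defs
  imports "HOL-Algebra.Algebraic_Closure" "HOL-Algebra.QuotRing"
begin

section \<open>Regular Hom-Lie algebras\<close>

text \<open>
  The ring multiplication slot \<open>mult\<close> of a module record carries the bracket and \<open>twist\<close> is the
  structure map \<open>\<phi>\<close>. The slot \<open>one\<close> has no meaning for Hom-Lie algebras and is never used.
\<close>

record ('k, 'a) hom_lie = "('k, 'a) module" +
  twist :: "'a \<Rightarrow> 'a" (\<open>\<phi>\<index>\<close>)

definition linear_map ::
    "('k, 'm) ring_scheme \<Rightarrow> ('k, 'a, 'n) module_scheme \<Rightarrow> ('k, 'b, 'o) module_scheme \<Rightarrow> ('a \<Rightarrow> 'b) \<Rightarrow> bool"
  where "linear_map K V W f \<longleftrightarrow>
    f \<in> carrier V \<rightarrow> carrier W \<and>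
    (\<forall>x \<in> carrier V. \<forall>y \<in> carrier V. f (x \<oplus>\<^bsub>V\<^esub> y) = f x \<oplus>\<^bsub>W\<^esub> f y) \<and>
    (\<forall>a \<in> carrier K. \<forall>x \<in> carrier V. f (a \<odot>\<^bsub>V\<^esub> x) = a \<odot>\<^bsub>W\<^esub> f x)"

locale hom_lie_algebra = module K L + field K
  for K :: "('k, 'm) ring_scheme" (structure) and L :: "('k, 'a) hom_lie" (structure) +
  assumes bracket_closed:
      "\<lbrakk> x \<in> carrier L; y \<in> carrier L \<rbrakk> \<Longrightarrow> x \<otimes>\<^bsub>L\<^esub> y \<in> carrier L"
    and bracket_add_left:
      "\<lbrakk> x \<in> carrier L; y \<in> carrier L; z \<in> carrier L \<rbrakk> \<Longrightarrow>
        (x \<oplus>\<^bsub>L\<^esub> y) \<otimes>\<^bsub>L\<^esub> z = x \<otimes>\<^bsub>L\<^esub> z \<oplus>\<^bsub>L\<^esub> y \<otimes>\<^bsub>L\<^esub> z"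
    and bracket_add_right:
      "\<lbrakk> x \<in> carrier L; y \<in> carrier L; z \<in> carrier L \<rbrakk> \<Longrightarrow>
        x \<otimes>\<^bsub>L\<^esub> (y \<oplus>\<^bsub>L\<^esub> z) = x \<otimes>\<^bsub>L\<^esub> y \<oplus>\<^bsub>L\<^esub> x \<otimes>\<^bsub>L\<^esub> z"
    and bracket_smult_left:
      "\<lbrakk> a \<in> carrier K; x \<in> carrier L; y \<in> carrier L \<rbrakk> \<Longrightarrow>
        (a \<odot>\<^bsub>L\<^esub> x) \<otimes>\<^bsub>L\<^esub> y = a \<odot>\<^bsub>L\<^esub> (x \<otimes>\<^bsub>L\<^esub> y)"
    and bracket_smult_right:
      "\<lbrakk> a \<in> carrier K; x \<in> carrier L; y \<in> carrier L \<rbrakk> \<Longrightarrow>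
        x \<otimes>\<^bsub>L\<^esub> (a \<odot>\<^bsub>L\<^esub> y) = a \<odot>\<^bsub>L\<^esub> (x \<otimes>\<^bsub>L\<^esub> y)"
    and bracket_skew:
      "\<lbrakk> x \<in> carrier L; y \<in> carrier L \<rbrakk> \<Longrightarrow> x \<otimes>\<^bsub>L\<^esub> y = \<ominus>\<^bsub>L\<^esub> (y \<otimes>\<^bsub>L\<^esub> x)"
    and twist_linear: "linear_map K L L \<phi>\<^bsub>L\<^esub>"
    and twist_bracket:
      "\<lbrakk> x \<in> carrier L; y \<in> carrier L \<rbrakk> \<Longrightarrow> \<phi>\<^bsub>L\<^esub> (x \<otimes>\<^bsub>L\<^esub> y) = \<phi>\<^bsub>L\<^esub> x \<otimes>\<^bsub>L\<^esub> \<phi>\<^bsub>L\<^esub> y"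
    and hom_jacobi:
      "\<lbrakk> x \<in> carrier L; y \<in> carrier L; z \<in> carrier L \<rbrakk> \<Longrightarrow>
        \<phi>\<^bsub>L\<^esub> x \<otimes>\<^bsub>L\<^esub> (y \<otimes>\<^bsub>L\<^esub> z) \<oplus>\<^bsub>L\<^esub> \<phi>\<^bsub>L\<^esub> y \<otimes>\<^bsub>L\<^esub> (z \<otimes>\<^bsub>L\<^esub> x) \<oplus>\<^bsub>L\<^esub> \<phi>\<^bsub>L\<^esub> z \<otimes>\<^bsub>L\<^esub> (x \<otimes>\<^bsub>L\<^esub> y)
          = \<zero>\<^bsub>L\<^esub>"

locale regular_hom_lie_algebra = hom_lie_algebra +
  assumes twist_bij: "bij_betw \<phi>\<^bsub>L\<^esub> (carrier L) (carrier L)"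

definition hom_lie_morphism ::
    "('k, 'm) ring_scheme \<Rightarrow> ('k, 'a) hom_lie \<Rightarrow> ('k, 'b) hom_lie \<Rightarrow> ('a \<Rightarrow> 'b) \<Rightarrow> bool"
  where "hom_lie_morphism K L M f \<longleftrightarrow>
    linear_map K L M f \<and>
    (\<forall>x \<in> carrier L. \<forall>y \<in> carrier L. f (x \<otimes>\<^bsub>L\<^esub> y) = f x \<otimes>\<^bsub>M\<^esub> f y) \<and>
    (\<forall>x \<in> carrier L. f (\<phi>\<^bsub>L\<^esub> x) = \<phi>\<^bsub>M\<^esub> (f x))"

text \<open>Extensionality makes equality of functions agree with equality on the carrier.\<close>

definition hom_lie_homs ::
    "('k, 'm) ring_scheme \<Rightarrow> ('k, 'a) hom_lie \<Rightarrow> ('k, 'b) hom_lie \<Rightarrow> ('a \<Rightarrow> 'b) set"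
  where "hom_lie_homs K L M = {f \<in> extensional (carrier L). hom_lie_morphism K L M f}"

definition hom_lie_center :: "('k, 'a) hom_lie \<Rightarrow> 'a set"
  where "hom_lie_center L = {u \<in> carrier L. \<forall>v \<in> carrier L. u \<otimes>\<^bsub>L\<^esub> v = \<zero>\<^bsub>L\<^esub>}"


section \<open>Derivations, inner and outer derivations\<close>

text \<open>
  Linear endomorphisms of \<open>V\<close> are represented by functions that are extensional on the carrier
  of \<open>V\<close>.
\<close>

definition inv_on :: "('k, 'a, 'n) module_scheme \<Rightarrow> ('a \<Rightarrow> 'a) \<Rightarrow> 'a \<Rightarrow> 'a"
  where "inv_on V \<beta> = (\<lambda>v \<in> carrier V. inv_into (carrier V) \<beta> v)"

definition Ad :: "('k, 'a, 'n) module_scheme \<Rightarrow> ('a \<Rightarrow> 'a) \<Rightarrow> ('a \<Rightarrow> 'a) \<Rightarrow> 'a \<Rightarrow> 'a"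
  where "Ad V \<beta> A = (\<lambda>v \<in> carrier V. \<beta> (A (inv_on V \<beta> v)))"

definition gl_bracket ::
    "('k, 'a, 'n) module_scheme \<Rightarrow> ('a \<Rightarrow> 'a) \<Rightarrow> ('a \<Rightarrow> 'a) \<Rightarrow> ('a \<Rightarrow> 'a) \<Rightarrow> 'a \<Rightarrow> 'a"
  where "gl_bracket V \<beta> A B =
    (\<lambda>v \<in> carrier V.
      \<beta> (A (inv_on V \<beta> (B (inv_on V \<beta> v)))) \<ominus>\<^bsub>V\<^esub> \<beta> (B (inv_on V \<beta> (A (inv_on V \<beta> v)))))"

definition gl ::
    "('k, 'm) ring_scheme \<Rightarrow> ('k, 'a, 'n) module_scheme \<Rightarrow> ('a \<Rightarrow> 'a) \<Rightarrow> ('k, 'a \<Rightarrow> 'a) hom_lie"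
  where "gl K V \<beta> =
    \<lparr>carrier = {A \<in> extensional (carrier V). linear_map K V V A},
     monoid.mult = gl_bracket V \<beta>,
     one = undefined,
     zero = (\<lambda>v \<in> carrier V. \<zero>\<^bsub>V\<^esub>),
     add = (\<lambda>A B. \<lambda>v \<in> carrier V. A v \<oplus>\<^bsub>V\<^esub> B v),
     smult = (\<lambda>a A. \<lambda>v \<in> carrier V. a \<odot>\<^bsub>V\<^esub> A v),
     twist = Ad V \<beta>\<rparr>"

definition is_derivation :: "('k, 'm) ring_scheme \<Rightarrow> ('k, 'a) hom_lie \<Rightarrow> ('a \<Rightarrow> 'a) \<Rightarrow> bool"
  where "is_derivation K L D \<longleftrightarrow>
    linear_map K L L D \<and>
    (\<forall>u \<in> carrier L. \<forall>v \<in> carrier L.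
      D (u \<otimes>\<^bsub>L\<^esub> v) =
        \<phi>\<^bsub>L\<^esub> u \<otimes>\<^bsub>L\<^esub> Ad L (inv_on L \<phi>\<^bsub>L\<^esub>) D v \<oplus>\<^bsub>L\<^esub> Ad L (inv_on L \<phi>\<^bsub>L\<^esub>) D u \<otimes>\<^bsub>L\<^esub> \<phi>\<^bsub>L\<^esub> v)"

definition Der :: "('k, 'm) ring_scheme \<Rightarrow> ('k, 'a) hom_lie \<Rightarrow> ('k, 'a \<Rightarrow> 'a) hom_lie"
  where "Der K L =
    (gl K L \<phi>\<^bsub>L\<^esub>)\<lparr>carrier := {D \<in> extensional (carrier L). is_derivation K L D}\<rparr>"

definition ad :: "('k, 'a) hom_lie \<Rightarrow> 'a \<Rightarrow> 'a \<Rightarrow> 'a"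
  where "ad L u = (\<lambda>v \<in> carrier L. u \<otimes>\<^bsub>L\<^esub> v)"

definition Inn :: "('k, 'm) ring_scheme \<Rightarrow> ('k, 'a) hom_lie \<Rightarrow> ('k, 'a \<Rightarrow> 'a) hom_lie"
  where "Inn K L = (Der K L)\<lparr>carrier := ad L ` carrier L\<rparr>"

definition hom_lie_quot :: "('k, 'a) hom_lie \<Rightarrow> 'a set \<Rightarrow> ('k, 'a set) hom_lie"
  where "hom_lie_quot L I =
    \<lparr>carrier = a_rcosets\<^bsub>L\<^esub> I,
     monoid.mult = rcoset_mult L I,
     one = undefined,
     zero = I,
     add = set_add L,
     smult = (\<lambda>a S. \<Union>x \<in> S. I +>\<^bsub>L\<^esub> (a \<odot>\<^bsub>L\<^esub> x)),
     twist = (\<lambda>S. \<Union>x \<in> S. I +>\<^bsub>L\<^esub> \<phi>\<^bsub>L\<^esub> x)\<rparr>"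

definition Out :: "('k, 'm) ring_scheme \<Rightarrow> ('k, 'a) hom_lie \<Rightarrow> ('k, ('a \<Rightarrow> 'a) set) hom_lie"
  where "Out K L = hom_lie_quot (Der K L) (carrier (Inn K L))"

definition out_proj ::
    "('k, 'm) ring_scheme \<Rightarrow> ('k, 'a) hom_lie \<Rightarrow> ('a \<Rightarrow> 'a) \<Rightarrow> ('a \<Rightarrow> 'a) set"
  where "out_proj K L D = carrier (Inn K L) +>\<^bsub>Der K L\<^esub> D"


section \<open>Non-abelian extensions\<close>

record ('k, 'g, 'h, 'e) lie_extension =
  total_alg :: "('k, 'e) hom_lie"
  incl :: "'h \<Rightarrow> 'e"
  proj :: "'e \<Rightarrow> 'g"

definition nonabelian_extension ::
    "('k, 'm) ring_scheme \<Rightarrow> ('k, 'g) hom_lie \<Rightarrow> ('k, 'h) hom_lie \<Rightarrow>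
      ('k, 'g, 'h, 'e) lie_extension \<Rightarrow> bool"
  where "nonabelian_extension K G H E \<longleftrightarrow>
    regular_hom_lie_algebra K G \<and> regular_hom_lie_algebra K H \<and>
    regular_hom_lie_algebra K (total_alg E) \<and>
    hom_lie_morphism K H (total_alg E) (incl E) \<and>
    hom_lie_morphism K (total_alg E) G (proj E) \<and>
    inj_on (incl E) (carrier H) \<and>
    incl E ` carrier H = a_kernel (total_alg E) G (proj E) \<and>
    proj E ` carrier (total_alg E) = carrier G"

definition diagonal_extension ::
    "('k, 'm) ring_scheme \<Rightarrow> ('k, 'g) hom_lie \<Rightarrow> ('k, 'h) hom_lie \<Rightarrow>
      ('k, 'g, 'h, 'e) lie_extension \<Rightarrow> bool"
  where "diagonal_extension K G H E \<longleftrightarrow>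
    nonabelian_extension K G H E \<and>
    (\<exists>S. submodule S K (total_alg E) \<and>
      twist (total_alg E) ` S \<subseteq> S \<and>
      incl E ` carrier H \<inter> S = {\<zero>\<^bsub>total_alg E\<^esub>} \<and>
      incl E ` carrier H <+>\<^bsub>total_alg E\<^esub> S = carrier (total_alg E))"

definition isomorphic_extensions ::
    "('k, 'm) ring_scheme \<Rightarrow> ('k, 'h) hom_lie \<Rightarrow>
      ('k, 'g, 'h, 'e) lie_extension \<Rightarrow> ('k, 'g, 'h, 'f) lie_extension \<Rightarrow> bool"
  where "isomorphic_extensions K H E1 E2 \<longleftrightarrow>
    (\<exists>\<theta>. hom_lie_morphism K (total_alg E2) (total_alg E1) \<theta> \<and>
      (\<forall>u \<in> carrier H. \<theta> (incl E2 u) = incl E1 u) \<and>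
      (\<forall>e \<in> carrier (total_alg E2). proj E1 (\<theta> e) = proj E2 e))"

definition diagonal_extensions ::
    "('k, 'm) ring_scheme \<Rightarrow> ('k, 'g) hom_lie \<Rightarrow> ('k, 'h) hom_lie \<Rightarrow>
      ('k, 'g, 'h, 'e) lie_extension set"
  where "diagonal_extensions K G H = {E. diagonal_extension K G H E}"

definition extension_iso_rel ::
    "('k, 'm) ring_scheme \<Rightarrow> ('k, 'g) hom_lie \<Rightarrow> ('k, 'h) hom_lie \<Rightarrow>
      (('k, 'g, 'h, 'e) lie_extension \<times> ('k, 'g, 'h, 'e) lie_extension) set"
  where "extension_iso_rel K G H =
    {(E1, E2) \<in> diagonal_extensions K G H \<times> diagonal_extensions K G H.
      isomorphic_extensions K H E1 E2}"


section \<open>The homomorphism induced by a diagonal extension\<close>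

definition diagonal_section ::
    "('k, 'm) ring_scheme \<Rightarrow> ('k, 'g) hom_lie \<Rightarrow> ('k, 'g, 'h, 'e) lie_extension \<Rightarrow>
      ('g \<Rightarrow> 'e) \<Rightarrow> bool"
  where "diagonal_section K G E s \<longleftrightarrow>
    linear_map K G (total_alg E) s \<and>
    (\<forall>x \<in> carrier G. proj E (s x) = x) \<and>
    (\<forall>x \<in> carrier G. twist (total_alg E) (s x) = s (\<phi>\<^bsub>G\<^esub> x))"

text \<open>The bracket with \<open>s x\<close>, transported from the image of \<open>incl E\<close> back to \<open>H\<close>.\<close>

definition section_action ::
    "('k, 'h) hom_lie \<Rightarrow> ('k, 'g, 'h, 'e) lie_extension \<Rightarrow> ('g \<Rightarrow> 'e) \<Rightarrow> 'g \<Rightarrow> 'h \<Rightarrow> 'h"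
  where "section_action H E s x =
    (\<lambda>u \<in> carrier H. inv_into (carrier H) (incl E) (s x \<otimes>\<^bsub>total_alg E\<^esub> incl E u))"

definition section_hom ::
    "('k, 'm) ring_scheme \<Rightarrow> ('k, 'g) hom_lie \<Rightarrow> ('k, 'h) hom_lie \<Rightarrow>
      ('k, 'g, 'h, 'e) lie_extension \<Rightarrow> ('g \<Rightarrow> 'e) \<Rightarrow> 'g \<Rightarrow> ('h \<Rightarrow> 'h) set"
  where "section_hom K G H E s = (\<lambda>x \<in> carrier G. out_proj K H (section_action H E s x))"

text \<open>The description operator is justified by independence of the diagonal section \<open>s\<close>.\<close>

definition induced_hom ::
    "('k, 'm) ring_scheme \<Rightarrow> ('k, 'g) hom_lie \<Rightarrow> ('k, 'h) hom_lie \<Rightarrow>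
      ('k, 'g, 'h, 'e) lie_extension \<Rightarrow> 'g \<Rightarrow> ('h \<Rightarrow> 'h) set"
  where "induced_hom K G H E =
    (THE f. \<exists>s. diagonal_section K G E s \<and> f = section_hom K G H E s)"

end

theory Submission
  imports Defs
begin

text \<open>
  Let \<open>E\<close> be an extension of \<open>G\<close> by \<open>H\<close>. Bracketing with an element \<open>e\<close> of the total algebra
  preserves the ideal \<open>H\<close>, and the Hom-Jacobi identity makes this a morphism \<open>act\<close> from the total
  algebra to \<open>Der H\<close> (\<open>hom_lie_ideal.act_morphism\<close>) that restricts to the adjoint map on \<open>H\<close>. Two
  elements over the same point of \<open>G\<close> therefore act by derivations that differ by an inner one, and
  the induced homomorphism is characterized, without sections, by sending \<open>proj e\<close> to the outer class
  of \<open>act e\<close> (\<open>outer_extension.induced_hom_proj\<close>).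

  Since the center of \<open>H\<close> is trivial, the pair \<open>(proj e, act e)\<close> determines \<open>e\<close>. It identifies the
  total algebra with the fibre product of \<open>G\<close> and \<open>Der H\<close> over \<open>Out H\<close>, formed along the induced
  homomorphism. An extension is thus recovered from its induced homomorphism: two diagonal
  extensions are isomorphic exactly when they induce the same homomorphism
  (\<open>outer_extension.induced_hom_eq_of_isomorphic\<close> and
  \<open>outer_extension.isomorphic_of_induced_hom_eq\<close>). In particular isomorphism is the kernel of the
  map from extensions to homomorphisms, hence an equivalence relation, and this map is injective on
  classes.

  Conversely, the fibre product along a given homomorphism \<open>f\<close> is an extension that induces \<open>f\<close>. It
  is diagonal because the extension of \<open>Out H\<close> by the inner derivations is: a section \<open>t\<close> of the
  latter gives the invariant complement of all \<open>(x, t (f x))\<close>. The same section provides coordinates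
  on the fibre product with values in the pairs of elements of \<open>G\<close> and \<open>H\<close>
  (\<open>outer_extension.exists_extension_inducing\<close>). No cocycle appears: all identities of the fibre
  product are inherited from its two factors (\<open>hom_lie_algebra_by_joint_embedding\<close>).
\<close>

section \<open>Linear maps and morphisms\<close>

lemma linear_mapD:
  assumes "linear_map K V W f"
  shows "x \<in> carrier V \<Longrightarrow> f x \<in> carrier W"
    and "x \<in> carrier V \<Longrightarrow> y \<in> carrier V \<Longrightarrow> f (x \<oplus>\<^bsub>V\<^esub> y) = f x \<oplus>\<^bsub>W\<^esub> f y"
    and "a \<in> carrier K \<Longrightarrow> x \<in> carrier V \<Longrightarrow> f (a \<odot>\<^bsub>V\<^esub> x) = a \<odot>\<^bsub>W\<^esub> f x"
  using assms by (auto simp: linear_map_def)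

lemma linear_map_zero:
  assumes "linear_map K V W f" "module K V" "module K W"
  shows "f \<zero>\<^bsub>V\<^esub> = \<zero>\<^bsub>W\<^esub>"
proof -
  interpret V: module K V by fact
  interpret W: module K W by fact
  have "f (\<zero>\<^bsub>K\<^esub> \<odot>\<^bsub>V\<^esub> \<zero>\<^bsub>V\<^esub>) = \<zero>\<^bsub>K\<^esub> \<odot>\<^bsub>W\<^esub> f \<zero>\<^bsub>V\<^esub>"
    using linear_mapD(3)[OF assms(1)] by blast
  then show ?thesis
    using linear_mapD(1)[OF assms(1), of "\<zero>\<^bsub>V\<^esub>"] by simp
qed

lemma linear_map_uminus:
  assumes "linear_map K V W f" "module K V" "module K W" "x \<in> carrier V"
  shows "f (\<ominus>\<^bsub>V\<^esub> x) = \<ominus>\<^bsub>W\<^esub> f x"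
proof -
  interpret V: module K V by fact
  interpret W: module K W by fact
  have "f ((\<ominus>\<^bsub>K\<^esub> \<one>\<^bsub>K\<^esub>) \<odot>\<^bsub>V\<^esub> x) = (\<ominus>\<^bsub>K\<^esub> \<one>\<^bsub>K\<^esub>) \<odot>\<^bsub>W\<^esub> f x"
    using linear_mapD(3)[OF assms(1)] assms(4) by simp
  then show ?thesis
    using linear_mapD(1)[OF assms(1), of x] assms(4) by (simp add: V.smult_l_minus W.smult_l_minus)
qed

lemma linear_map_minus:
  assumes "linear_map K V W f" "module K V" "module K W" "x \<in> carrier V" "y \<in> carrier V"
  shows "f (x \<ominus>\<^bsub>V\<^esub> y) = f x \<ominus>\<^bsub>W\<^esub> f y"
proof -
  interpret V: module K V by fact
  interpret W: module K W by fact
  show ?thesis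
    using assms(4,5) linear_mapD(1,2)[OF assms(1)] linear_map_uminus[OF assms(1-3)]
    by (simp add: V.minus_eq W.minus_eq)
qed

lemma hom_lie_morphismD:
  assumes "hom_lie_morphism K L M f"
  shows "linear_map K L M f"
    and "x \<in> carrier L \<Longrightarrow> f x \<in> carrier M"
    and "x \<in> carrier L \<Longrightarrow> y \<in> carrier L \<Longrightarrow> f (x \<oplus>\<^bsub>L\<^esub> y) = f x \<oplus>\<^bsub>M\<^esub> f y"
    and "a \<in> carrier K \<Longrightarrow> x \<in> carrier L \<Longrightarrow> f (a \<odot>\<^bsub>L\<^esub> x) = a \<odot>\<^bsub>M\<^esub> f x"
    and "x \<in> carrier L \<Longrightarrow> y \<in> carrier L \<Longrightarrow> f (x \<otimes>\<^bsub>L\<^esub> y) = f x \<otimes>\<^bsub>M\<^esub> f y"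
    and "x \<in> carrier L \<Longrightarrow> f (\<phi>\<^bsub>L\<^esub> x) = \<phi>\<^bsub>M\<^esub> (f x)"
  using assms by (auto simp: hom_lie_morphism_def linear_map_def)

lemma hom_lie_morphismI:
  assumes "\<And>x. x \<in> carrier L \<Longrightarrow> f x \<in> carrier M"
    and "\<And>x y. x \<in> carrier L \<Longrightarrow> y \<in> carrier L \<Longrightarrow> f (x \<oplus>\<^bsub>L\<^esub> y) = f x \<oplus>\<^bsub>M\<^esub> f y"
    and "\<And>a x. a \<in> carrier K \<Longrightarrow> x \<in> carrier L \<Longrightarrow> f (a \<odot>\<^bsub>L\<^esub> x) = a \<odot>\<^bsub>M\<^esub> f x"
    and "\<And>x y. x \<in> carrier L \<Longrightarrow> y \<in> carrier L \<Longrightarrow> f (x \<otimes>\<^bsub>L\<^esub> y) = f x \<otimes>\<^bsub>M\<^esub> f y"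
    and "\<And>x. x \<in> carrier L \<Longrightarrow> f (\<phi>\<^bsub>L\<^esub> x) = \<phi>\<^bsub>M\<^esub> (f x)"
  shows "hom_lie_morphism K L M f"
  using assms by (auto simp: hom_lie_morphism_def linear_map_def)

lemma hom_lie_morphism_comp:
  assumes "hom_lie_morphism K L M f" "hom_lie_morphism K M N g"
  shows "hom_lie_morphism K L N (\<lambda>x. g (f x))"
  using hom_lie_morphismD[OF assms(1)] hom_lie_morphismD[OF assms(2)]
  by (intro hom_lie_morphismI) auto

lemma (in abelian_group) minus_eq_zero_iff:
  assumes "x \<in> carrier G" "y \<in> carrier G"
  shows "x \<ominus> y = \<zero> \<longleftrightarrow> x = y"
  using assms minus_equality[of x "\<ominus> y"] by (auto simp: minus_eq r_neg)

lemma (in abelian_group) minus_add_cancel: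
  assumes "x \<in> carrier G" "y \<in> carrier G"
  shows "y \<oplus> (x \<ominus> y) = x"
  using assms by (simp add: minus_eq a_lcomm[of y x] r_neg)

lemma linear_map_inj_on:
  assumes "linear_map K V W f" "module K V" "module K W"
    and "\<And>x. x \<in> carrier V \<Longrightarrow> f x = \<zero>\<^bsub>W\<^esub> \<Longrightarrow> x = \<zero>\<^bsub>V\<^esub>"
  shows "inj_on f (carrier V)"
proof (rule inj_onI)
  interpret V: module K V by fact
  interpret W: module K W by fact
  fix x y assume xy: "x \<in> carrier V" "y \<in> carrier V" "f x = f y"
  have "f (x \<ominus>\<^bsub>V\<^esub> y) = \<zero>\<^bsub>W\<^esub>"
    using xy linear_map_minus[OF assms(1-3)] linear_mapD(1)[OF assms(1)]
    by (simp add: W.minus_eq_zero_iff)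
  then have "x \<ominus>\<^bsub>V\<^esub> y = \<zero>\<^bsub>V\<^esub>"
    using assms(4) xy by blast
  then show "x = y"
    using xy by (simp add: V.minus_eq_zero_iff)
qed

text \<open>
  A candidate structure that maps, compatibly with all operations, into two Hom-Lie algebras by
  jointly injective maps inherits every identity from them. In this way a fibre product can be
  recognized as a Hom-Lie algebra in any coordinates, without touching the Jacobi identity.
\<close>

lemma hom_lie_algebra_by_joint_embedding:
  fixes L :: "('k, 'c) hom_lie" and A :: "('k, 'a) hom_lie" and B :: "('k, 'b) hom_lie"
  assumes A: "hom_lie_algebra K A" and B: "hom_lie_algebra K B"
    and f: "hom_lie_morphism K L A f" and g: "hom_lie_morphism K L B g"
    and f0: "f \<zero>\<^bsub>L\<^esub> = \<zero>\<^bsub>A\<^esub>" and g0: "g \<zero>\<^bsub>L\<^esub> = \<zero>\<^bsub>B\<^esub>"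
    and inj: "\<And>x y. x \<in> carrier L \<Longrightarrow> y \<in> carrier L \<Longrightarrow> f x = f y \<Longrightarrow> g x = g y \<Longrightarrow> x = y"
    and zero: "\<zero>\<^bsub>L\<^esub> \<in> carrier L"
    and add: "\<And>x y. x \<in> carrier L \<Longrightarrow> y \<in> carrier L \<Longrightarrow> x \<oplus>\<^bsub>L\<^esub> y \<in> carrier L"
    and smult: "\<And>a x. a \<in> carrier K \<Longrightarrow> x \<in> carrier L \<Longrightarrow> a \<odot>\<^bsub>L\<^esub> x \<in> carrier L"
    and bracket: "\<And>x y. x \<in> carrier L \<Longrightarrow> y \<in> carrier L \<Longrightarrow> x \<otimes>\<^bsub>L\<^esub> y \<in> carrier L"
    and twist: "\<And>x. x \<in> carrier L \<Longrightarrow> \<phi>\<^bsub>L\<^esub> x \<in> carrier L"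
  shows "hom_lie_algebra K L"
proof -
  interpret A: hom_lie_algebra K A by fact
  interpret B: hom_lie_algebra K B by fact
  note closed = zero add smult bracket twist hom_lie_morphismD(2)[OF f] hom_lie_morphismD(2)[OF g]
    A.bracket_closed B.bracket_closed
    linear_mapD(1)[OF A.twist_linear] linear_mapD(1)[OF B.twist_linear]
  note push = hom_lie_morphismD(3-)[OF f] hom_lie_morphismD(3-)[OF g] f0 g0
  have "abelian_group L"
  proof (rule abelian_groupI)
    fix x assume x: "x \<in> carrier L"
    show "\<exists>y\<in>carrier L. y \<oplus>\<^bsub>L\<^esub> x = \<zero>\<^bsub>L\<^esub>"
      using x by (intro bexI[of _ "(\<ominus>\<^bsub>K\<^esub> \<one>\<^bsub>K\<^esub>) \<odot>\<^bsub>L\<^esub> x"] inj)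
        (simp_all add: closed push A.smult_l_minus B.smult_l_minus A.M.l_neg B.M.l_neg)
  qed (auto intro!: inj simp: closed push A.M.a_ac B.M.a_ac)
  then interpret L: module K L
    by (intro moduleI A.R.is_cring; simp)
       (auto intro!: inj simp: closed push A.smult_l_distr B.smult_l_distr
         A.smult_r_distr B.smult_r_distr A.smult_assoc1 B.smult_assoc1)
  have neg: "f (\<ominus>\<^bsub>L\<^esub> x) = \<ominus>\<^bsub>A\<^esub> f x" "g (\<ominus>\<^bsub>L\<^esub> x) = \<ominus>\<^bsub>B\<^esub> g x" if "x \<in> carrier L" for x
    using that linear_map_uminus[OF hom_lie_morphismD(1)[OF f] L.module_axioms A.module_axioms]
      linear_map_uminus[OF hom_lie_morphismD(1)[OF g] L.module_axioms B.module_axioms] by auto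
  show ?thesis
  proof (unfold_locales, goal_cases)
    case (6 x y)
    then show ?case
      by (intro inj) (simp_all add: closed push neg A.bracket_skew[of "f x"] B.bracket_skew[of "g x"])
  next
    case 7
    then show ?case
      unfolding linear_map_def
      by (auto intro!: inj simp: closed push linear_mapD(2,3)[OF A.twist_linear]
          linear_mapD(2,3)[OF B.twist_linear])
  next
    case (9 x y z)
    then show ?case
      by (intro inj) (simp_all add: closed push A.hom_jacobi B.hom_jacobi)
  qed (auto intro!: inj simp: closed push A.bracket_add_left B.bracket_add_left
      A.bracket_add_right B.bracket_add_right A.bracket_smult_left B.bracket_smult_left
      A.bracket_smult_right B.bracket_smult_right A.twist_bracket B.twist_bracket)
qed

lemma hom_lie_morphism_by_joint_embedding:
  fixes L :: "('k, 'c) hom_lie" and A :: "('k, 'a) hom_lie" and B :: "('k, 'b) hom_lie"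
  assumes L: "hom_lie_algebra K L" and M: "hom_lie_algebra K M"
    and f: "hom_lie_morphism K L A f" and g: "hom_lie_morphism K L B g"
    and inj: "\<And>x y. x \<in> carrier L \<Longrightarrow> y \<in> carrier L \<Longrightarrow> f x = f y \<Longrightarrow> g x = g y \<Longrightarrow> x = y"
    and f': "hom_lie_morphism K M A f'" and g': "hom_lie_morphism K M B g'"
    and \<theta>: "\<And>m. m \<in> carrier M \<Longrightarrow> \<theta> m \<in> carrier L"
    and f\<theta>: "\<And>m. m \<in> carrier M \<Longrightarrow> f (\<theta> m) = f' m"
    and g\<theta>: "\<And>m. m \<in> carrier M \<Longrightarrow> g (\<theta> m) = g' m"
  shows "hom_lie_morphism K M L \<theta>"
proof -
  interpret L: hom_lie_algebra K L by fact
  interpret M: hom_lie_algebra K M by fact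
  note closed = L.bracket_closed M.bracket_closed \<theta>
    linear_mapD(1)[OF L.twist_linear] linear_mapD(1)[OF M.twist_linear]
  note push = hom_lie_morphismD(3-)[OF f] hom_lie_morphismD(3-)[OF g]
    hom_lie_morphismD(3-)[OF f'] hom_lie_morphismD(3-)[OF g'] f\<theta> g\<theta>
  show ?thesis
    by (intro hom_lie_morphismI) (auto intro!: inj simp: closed push)
qed

section \<open>Derivations and ideals\<close>

context hom_lie_algebra
begin

lemma twist_closed: "x \<in> carrier L \<Longrightarrow> \<phi>\<^bsub>L\<^esub> x \<in> carrier L"
  using linear_mapD(1)[OF twist_linear] .

lemma bracket_zero_right: "x \<in> carrier L \<Longrightarrow> x \<otimes>\<^bsub>L\<^esub> \<zero>\<^bsub>L\<^esub> = \<zero>\<^bsub>L\<^esub>"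
  using bracket_smult_right[of "\<zero>\<^bsub>K\<^esub>" x "\<zero>\<^bsub>L\<^esub>"] bracket_closed[of x "\<zero>\<^bsub>L\<^esub>"] by simp

lemma bracket_uminus_right:
  "x \<in> carrier L \<Longrightarrow> y \<in> carrier L \<Longrightarrow> x \<otimes>\<^bsub>L\<^esub> (\<ominus>\<^bsub>L\<^esub> y) = \<ominus>\<^bsub>L\<^esub> (x \<otimes>\<^bsub>L\<^esub> y)"
  using bracket_smult_right[of "\<ominus>\<^bsub>K\<^esub> \<one>\<^bsub>K\<^esub>" x y] bracket_closed[of x y]
  by (simp add: smult_l_minus)

text \<open>The Hom-Jacobi identity, read as a Leibniz rule for the bracket with a fixed element.\<close>

lemma hom_leibniz:
  assumes "x \<in> carrier L" "y \<in> carrier L" "z \<in> carrier L"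
  shows "\<phi>\<^bsub>L\<^esub> x \<otimes>\<^bsub>L\<^esub> (y \<otimes>\<^bsub>L\<^esub> z) =
    \<phi>\<^bsub>L\<^esub> y \<otimes>\<^bsub>L\<^esub> (x \<otimes>\<^bsub>L\<^esub> z) \<oplus>\<^bsub>L\<^esub> (x \<otimes>\<^bsub>L\<^esub> y) \<otimes>\<^bsub>L\<^esub> \<phi>\<^bsub>L\<^esub> z"
proof -
  note [simp] = assms bracket_closed twist_closed
  have "\<phi>\<^bsub>L\<^esub> x \<otimes>\<^bsub>L\<^esub> (y \<otimes>\<^bsub>L\<^esub> z) \<oplus>\<^bsub>L\<^esub> (\<phi>\<^bsub>L\<^esub> y \<otimes>\<^bsub>L\<^esub> (z \<otimes>\<^bsub>L\<^esub> x) \<oplus>\<^bsub>L\<^esub> \<phi>\<^bsub>L\<^esub> z \<otimes>\<^bsub>L\<^esub> (x \<otimes>\<^bsub>L\<^esub> y)) = \<zero>\<^bsub>L\<^esub>"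
    using hom_jacobi[of x y z] by (simp add: M.a_assoc)
  then have "\<phi>\<^bsub>L\<^esub> x \<otimes>\<^bsub>L\<^esub> (y \<otimes>\<^bsub>L\<^esub> z) =
      \<ominus>\<^bsub>L\<^esub> (\<phi>\<^bsub>L\<^esub> y \<otimes>\<^bsub>L\<^esub> (z \<otimes>\<^bsub>L\<^esub> x) \<oplus>\<^bsub>L\<^esub> \<phi>\<^bsub>L\<^esub> z \<otimes>\<^bsub>L\<^esub> (x \<otimes>\<^bsub>L\<^esub> y))"
    by (intro M.minus_equality[symmetric]) simp_all
  also have "\<dots> = \<ominus>\<^bsub>L\<^esub> (\<phi>\<^bsub>L\<^esub> y \<otimes>\<^bsub>L\<^esub> (z \<otimes>\<^bsub>L\<^esub> x)) \<oplus>\<^bsub>L\<^esub> \<ominus>\<^bsub>L\<^esub> (\<phi>\<^bsub>L\<^esub> z \<otimes>\<^bsub>L\<^esub> (x \<otimes>\<^bsub>L\<^esub> y))"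
    by (simp add: M.minus_add)
  also have "\<ominus>\<^bsub>L\<^esub> (\<phi>\<^bsub>L\<^esub> y \<otimes>\<^bsub>L\<^esub> (z \<otimes>\<^bsub>L\<^esub> x)) = \<phi>\<^bsub>L\<^esub> y \<otimes>\<^bsub>L\<^esub> (x \<otimes>\<^bsub>L\<^esub> z)"
    using bracket_skew[of x z] by (simp add: bracket_uminus_right)
  also have "\<ominus>\<^bsub>L\<^esub> (\<phi>\<^bsub>L\<^esub> z \<otimes>\<^bsub>L\<^esub> (x \<otimes>\<^bsub>L\<^esub> y)) = (x \<otimes>\<^bsub>L\<^esub> y) \<otimes>\<^bsub>L\<^esub> \<phi>\<^bsub>L\<^esub> z"
    using bracket_skew[of "x \<otimes>\<^bsub>L\<^esub> y" "\<phi>\<^bsub>L\<^esub> z"] by simp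
  finally show ?thesis .
qed

lemma bracket_bracket:
  assumes "x \<in> carrier L" "y \<in> carrier L" "z \<in> carrier L"
  shows "(x \<otimes>\<^bsub>L\<^esub> y) \<otimes>\<^bsub>L\<^esub> \<phi>\<^bsub>L\<^esub> z =
    \<phi>\<^bsub>L\<^esub> x \<otimes>\<^bsub>L\<^esub> (y \<otimes>\<^bsub>L\<^esub> z) \<ominus>\<^bsub>L\<^esub> \<phi>\<^bsub>L\<^esub> y \<otimes>\<^bsub>L\<^esub> (x \<otimes>\<^bsub>L\<^esub> z)"
  using assms M.a_comm[of "\<phi>\<^bsub>L\<^esub> y \<otimes>\<^bsub>L\<^esub> (x \<otimes>\<^bsub>L\<^esub> z)" "(x \<otimes>\<^bsub>L\<^esub> y) \<otimes>\<^bsub>L\<^esub> \<phi>\<^bsub>L\<^esub> z"]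
  by (simp add: hom_leibniz[OF assms] bracket_closed twist_closed M.minus_eq M.a_assoc M.r_neg)

end

lemma Der_simps:
  "carrier (Der K L) = {D \<in> extensional (carrier L). is_derivation K L D}"
  "A \<otimes>\<^bsub>Der K L\<^esub> B = gl_bracket L \<phi>\<^bsub>L\<^esub> A B"
  "\<zero>\<^bsub>Der K L\<^esub> = (\<lambda>v \<in> carrier L. \<zero>\<^bsub>L\<^esub>)"
  "A \<oplus>\<^bsub>Der K L\<^esub> B = (\<lambda>v \<in> carrier L. A v \<oplus>\<^bsub>L\<^esub> B v)"
  "a \<odot>\<^bsub>Der K L\<^esub> A = (\<lambda>v \<in> carrier L. a \<odot>\<^bsub>L\<^esub> A v)"
  "\<phi>\<^bsub>Der K L\<^esub> A = Ad L \<phi>\<^bsub>L\<^esub> A"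
  by (simp_all add: Der_def gl_def)

context regular_hom_lie_algebra
begin

lemma twist_inv:
  assumes "x \<in> carrier L"
  shows "inv_on L \<phi>\<^bsub>L\<^esub> x \<in> carrier L" "\<phi>\<^bsub>L\<^esub> (inv_on L \<phi>\<^bsub>L\<^esub> x) = x" "inv_on L \<phi>\<^bsub>L\<^esub> (\<phi>\<^bsub>L\<^esub> x) = x"
  using assms twist_bij
  by (auto simp: inv_on_def bij_betw_def inv_into_into f_inv_into_f twist_closed)

lemma twist_inv_unique:
  "x \<in> carrier L \<Longrightarrow> y \<in> carrier L \<Longrightarrow> \<phi>\<^bsub>L\<^esub> y = x \<Longrightarrow> inv_on L \<phi>\<^bsub>L\<^esub> x = y"
  using twist_inv by blast

lemma inv_on_inv_on_twist:
  assumes "x \<in> carrier L"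
  shows "inv_on L (inv_on L \<phi>\<^bsub>L\<^esub>) x = \<phi>\<^bsub>L\<^esub> x"
proof -
  have "inj_on (inv_on L \<phi>\<^bsub>L\<^esub>) (carrier L)"
    by (rule inj_on_inverseI[of _ "\<phi>\<^bsub>L\<^esub>"]) (simp add: twist_inv)
  then have "inv_into (carrier L) (inv_on L \<phi>\<^bsub>L\<^esub>) x = \<phi>\<^bsub>L\<^esub> x"
    using assms by (intro inv_into_f_eq) (simp_all add: twist_inv twist_closed)
  then show ?thesis
    using assms by (simp add: inv_on_def[of _ "inv_on L \<phi>\<^bsub>L\<^esub>"])
qed

lemma is_derivation_iff:
  "is_derivation K L D \<longleftrightarrow> linear_map K L L D \<and>
    (\<forall>u \<in> carrier L. \<forall>v \<in> carrier L. D (u \<otimes>\<^bsub>L\<^esub> v) =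
      \<phi>\<^bsub>L\<^esub> u \<otimes>\<^bsub>L\<^esub> inv_on L \<phi>\<^bsub>L\<^esub> (D (\<phi>\<^bsub>L\<^esub> v)) \<oplus>\<^bsub>L\<^esub> inv_on L \<phi>\<^bsub>L\<^esub> (D (\<phi>\<^bsub>L\<^esub> u)) \<otimes>\<^bsub>L\<^esub> \<phi>\<^bsub>L\<^esub> v)"
  by (simp add: is_derivation_def Ad_def inv_on_inv_on_twist cong: conj_cong)

lemma Der_apply_closed: "D \<in> carrier (Der K L) \<Longrightarrow> u \<in> carrier L \<Longrightarrow> D u \<in> carrier L"
  by (auto simp: Der_simps is_derivation_iff linear_map_def)

lemma Der_eqI:
  assumes "A \<in> extensional (carrier L)" "B \<in> extensional (carrier L)"
    and "\<And>u. u \<in> carrier L \<Longrightarrow> A (\<phi>\<^bsub>L\<^esub> u) = B (\<phi>\<^bsub>L\<^esub> u)"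
  shows "A = B"
proof (rule extensionalityI[OF assms(1,2)])
  fix u assume "u \<in> carrier L"
  then show "A u = B u" using assms(3)[of "inv_on L \<phi>\<^bsub>L\<^esub> u"] by (simp add: twist_inv)
qed

lemma gl_bracket_twist:
  assumes "A \<in> carrier L \<rightarrow> carrier L" "B \<in> carrier L \<rightarrow> carrier L" "u \<in> carrier L"
  shows "gl_bracket L \<phi>\<^bsub>L\<^esub> A B (\<phi>\<^bsub>L\<^esub> u) =
    \<phi>\<^bsub>L\<^esub> (A (inv_on L \<phi>\<^bsub>L\<^esub> (B u))) \<ominus>\<^bsub>L\<^esub> \<phi>\<^bsub>L\<^esub> (B (inv_on L \<phi>\<^bsub>L\<^esub> (A u)))"
  using assms by (simp add: gl_bracket_def twist_inv twist_closed)

lemma inv_twist_bracket: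
  assumes "x \<in> carrier L" "y \<in> carrier L"
  shows "inv_on L \<phi>\<^bsub>L\<^esub> (x \<otimes>\<^bsub>L\<^esub> y) = inv_on L \<phi>\<^bsub>L\<^esub> x \<otimes>\<^bsub>L\<^esub> inv_on L \<phi>\<^bsub>L\<^esub> y"
  using assms by (intro twist_inv_unique) (simp_all add: twist_inv bracket_closed twist_bracket)

end

text \<open>
  An algebra \<open>H\<close> embedded as an ideal in \<open>T\<close>. The bracket of \<open>T\<close> then lets every element of \<open>T\<close> act
  on \<open>H\<close>; this covers both the kernel of an extension and, with \<open>T = H\<close>, the adjoint map.
\<close>

locale hom_lie_ideal = H: regular_hom_lie_algebra K H + T: regular_hom_lie_algebra K T
  for K :: "('k, 'm) ring_scheme" and H :: "('k, 'h) hom_lie" and T :: "('k, 'e) hom_lie" +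
  fixes i :: "'h \<Rightarrow> 'e"
  assumes i_morphism: "hom_lie_morphism K H T i"
    and i_inj: "inj_on i (carrier H)"
    and i_ideal: "e \<in> carrier T \<Longrightarrow> u \<in> carrier H \<Longrightarrow> e \<otimes>\<^bsub>T\<^esub> i u \<in> i ` carrier H"

definition ideal_action ::
    "('k, 'h) hom_lie \<Rightarrow> ('k, 'e) hom_lie \<Rightarrow> ('h \<Rightarrow> 'e) \<Rightarrow> 'e \<Rightarrow> 'h \<Rightarrow> 'h"
  where "ideal_action H T i e = (\<lambda>u \<in> carrier H. inv_into (carrier H) i (e \<otimes>\<^bsub>T\<^esub> i u))"

context hom_lie_ideal
begin

abbreviation "act \<equiv> ideal_action H T i"

lemmas i_closed = hom_lie_morphismD(2)[OF i_morphism]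
lemmas i_hom = hom_lie_morphismD(3-)[OF i_morphism]

lemma act_closed: "e \<in> carrier T \<Longrightarrow> u \<in> carrier H \<Longrightarrow> act e u \<in> carrier H"
  using i_ideal by (simp add: ideal_action_def inv_into_into)

lemma i_act: "e \<in> carrier T \<Longrightarrow> u \<in> carrier H \<Longrightarrow> i (act e u) = e \<otimes>\<^bsub>T\<^esub> i u"
  using i_ideal by (simp add: ideal_action_def f_inv_into_f)

lemma act_eqI:
  "e \<in> carrier T \<Longrightarrow> u \<in> carrier H \<Longrightarrow> w \<in> carrier H \<Longrightarrow> i w = e \<otimes>\<^bsub>T\<^esub> i u \<Longrightarrow> act e u = w"
  using i_act act_closed i_inj by (metis inj_onD)

lemma act_extensional: "act e \<in> extensional (carrier H)"
  by (simp add: ideal_action_def)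

lemma act_i: "u \<in> carrier H \<Longrightarrow> act (i u) = ad H u"
  by (rule extensionalityI[OF act_extensional])
    (auto simp: ad_def i_closed i_hom H.bracket_closed intro!: act_eqI)

lemma inv_twist_act:
  assumes "e \<in> carrier T" "u \<in> carrier H"
  shows "inv_on H \<phi>\<^bsub>H\<^esub> (act (\<phi>\<^bsub>T\<^esub> e) (\<phi>\<^bsub>H\<^esub> u)) = act e u"
proof (rule H.twist_inv_unique)
  show "\<phi>\<^bsub>H\<^esub> (act e u) = act (\<phi>\<^bsub>T\<^esub> e) (\<phi>\<^bsub>H\<^esub> u)"
    using assms by (intro act_eqI[symmetric])
      (simp_all add: act_closed i_act i_closed i_hom H.twist_closed T.twist_closed T.twist_bracket)
qed (simp_all add: assms act_closed H.twist_closed T.twist_closed)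

lemma act_linear:
  assumes "e \<in> carrier T"
  shows "linear_map K H H (act e)"
  using assms unfolding linear_map_def
  by (auto simp: act_closed i_act i_closed i_hom T.bracket_add_right T.bracket_smult_right
      intro!: act_eqI)

lemma act_derivation:
  assumes e: "e \<in> carrier T"
  shows "act e \<in> carrier (Der K H)"
proof -
  \<comment> \<open>The Leibniz rule of \<open>act e\<close> is the Hom-Jacobi identity at the preimage of \<open>e\<close> under the twist.\<close>
  define d where "d = inv_on T \<phi>\<^bsub>T\<^esub> e"
  have d: "d \<in> carrier T" "e = \<phi>\<^bsub>T\<^esub> d"
    using T.twist_inv[OF e] by (simp_all add: d_def)
  have "act e (u \<otimes>\<^bsub>H\<^esub> v) = \<phi>\<^bsub>H\<^esub> u \<otimes>\<^bsub>H\<^esub> act d v \<oplus>\<^bsub>H\<^esub> act d u \<otimes>\<^bsub>H\<^esub> \<phi>\<^bsub>H\<^esub> v"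
    if "u \<in> carrier H" "v \<in> carrier H" for u v
    using that d(1) T.hom_leibniz[of d "i u" "i v"] unfolding d(2)
    by (intro act_eqI)
      (simp_all add: act_closed i_act i_closed i_hom H.bracket_closed H.twist_closed T.twist_closed)
  then show ?thesis
    using act_linear[OF e] act_extensional d
    by (simp add: Der_simps H.is_derivation_iff inv_twist_act)
qed

text \<open>
  Multiplicativity is again the Hom-Jacobi identity: evaluated at \<open>\<phi> u\<close>, the twisted commutator of
  \<open>act e\<close> and \<open>act d\<close> becomes the difference of two iterated brackets.
\<close>

lemma act_morphism: "hom_lie_morphism K T (Der K H) act"
proof (rule hom_lie_morphismI)
  fix x assume x: "x \<in> carrier T"
  show "act x \<in> carrier (Der K H)" by (rule act_derivation[OF x])
  show "act (\<phi>\<^bsub>T\<^esub> x) = \<phi>\<^bsub>Der K H\<^esub> (act x)"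
  proof (rule H.Der_eqI)
    fix u assume u: "u \<in> carrier H"
    then show "act (\<phi>\<^bsub>T\<^esub> x) (\<phi>\<^bsub>H\<^esub> u) = \<phi>\<^bsub>Der K H\<^esub> (act x) (\<phi>\<^bsub>H\<^esub> u)"
      using x by (intro act_eqI) (simp_all add: Der_simps Ad_def H.twist_inv act_closed i_act
          i_closed i_hom H.twist_closed T.twist_closed T.twist_bracket)
  qed (simp_all add: Der_simps Ad_def act_extensional)
next
  fix x y assume xy: "x \<in> carrier T" "y \<in> carrier T"
  show "act (x \<oplus>\<^bsub>T\<^esub> y) = act x \<oplus>\<^bsub>Der K H\<^esub> act y"
    using xy by (intro extensionalityI[OF act_extensional])
      (auto simp: Der_simps act_closed i_act i_closed i_hom T.bracket_add_left intro!: act_eqI)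
  show "act (x \<otimes>\<^bsub>T\<^esub> y) = act x \<otimes>\<^bsub>Der K H\<^esub> act y"
  proof (rule H.Der_eqI)
    fix u assume u: "u \<in> carrier H"
    have step: "\<phi>\<^bsub>H\<^esub> (act a (inv_on H \<phi>\<^bsub>H\<^esub> w)) = act (\<phi>\<^bsub>T\<^esub> a) w"
      if "a \<in> carrier T" "w \<in> carrier H" for a w
      using that inv_twist_act[of a "inv_on H \<phi>\<^bsub>H\<^esub> w"]
        H.twist_inv(2)[of "act (\<phi>\<^bsub>T\<^esub> a) w"]
      by (simp add: H.twist_inv act_closed T.twist_closed)
    have "act (x \<otimes>\<^bsub>T\<^esub> y) (\<phi>\<^bsub>H\<^esub> u) = act (\<phi>\<^bsub>T\<^esub> x) (act y u) \<ominus>\<^bsub>H\<^esub> act (\<phi>\<^bsub>T\<^esub> y) (act x u)"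
      using xy u linear_map_minus[OF hom_lie_morphismD(1)[OF i_morphism] H.module_axioms T.module_axioms]
      by (intro act_eqI) (simp_all add: act_closed i_act i_closed i_hom H.twist_closed
          T.twist_closed T.bracket_closed T.bracket_bracket)
    then show "act (x \<otimes>\<^bsub>T\<^esub> y) (\<phi>\<^bsub>H\<^esub> u) = (act x \<otimes>\<^bsub>Der K H\<^esub> act y) (\<phi>\<^bsub>H\<^esub> u)"
      using xy u by (simp add: Der_simps H.gl_bracket_twist act_closed step)
  qed (simp_all add: Der_simps gl_bracket_def act_extensional)
next
  fix a x assume "a \<in> carrier K" "x \<in> carrier T"
  then show "act (a \<odot>\<^bsub>T\<^esub> x) = a \<odot>\<^bsub>Der K H\<^esub> act x"
    by (intro extensionalityI[OF act_extensional])
      (auto simp: Der_simps act_closed i_act i_closed i_hom T.bracket_smult_left intro!: act_eqI)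
qed

end

context regular_hom_lie_algebra
begin

lemma hom_lie_ideal_self: "hom_lie_ideal K L L (\<lambda>u. u)"
proof (intro hom_lie_ideal.intro hom_lie_ideal_axioms.intro)
  show "hom_lie_morphism K L L (\<lambda>u. u)"
    by (intro hom_lie_morphismI) simp_all
qed (simp_all add: regular_hom_lie_algebra_axioms bracket_closed)

lemma ad_morphism: "hom_lie_morphism K L (Der K L) (ad L)"
proof -
  interpret self: hom_lie_ideal K L L "\<lambda>u. u" by (rule hom_lie_ideal_self)
  show ?thesis
    using self.act_morphism self.act_derivation
    by (simp add: self.act_i hom_lie_morphism_def linear_map_def bracket_closed twist_closed)
qed

text \<open>
  In the twisted commutator at \<open>\<phi> w\<close>, the Leibniz rule splits the term in which \<open>D\<close> is applied last
  into two brackets. One of them cancels the other term, and the bracket with \<open>D u\<close> remains.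
\<close>

lemma Der_bracket_ad:
  assumes D: "D \<in> carrier (Der K L)" and u: "u \<in> carrier L"
  shows "D \<otimes>\<^bsub>Der K L\<^esub> ad L u = ad L (D u)"
proof (rule Der_eqI)
  let ?inv = "inv_on L \<phi>\<^bsub>L\<^esub>"
  fix w assume w: "w \<in> carrier L"
  note Dc = Der_apply_closed[OF D]
  note [simp] = u w Dc bracket_closed twist_closed twist_inv twist_bracket inv_twist_bracket
  have "D (?inv u \<otimes>\<^bsub>L\<^esub> ?inv w) = u \<otimes>\<^bsub>L\<^esub> ?inv (D w) \<oplus>\<^bsub>L\<^esub> ?inv (D u) \<otimes>\<^bsub>L\<^esub> w"
    using D by (simp add: Der_simps is_derivation_iff)
  then have "(D \<otimes>\<^bsub>Der K L\<^esub> ad L u) (\<phi>\<^bsub>L\<^esub> w) =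
      \<phi>\<^bsub>L\<^esub> (u \<otimes>\<^bsub>L\<^esub> ?inv (D w) \<oplus>\<^bsub>L\<^esub> ?inv (D u) \<otimes>\<^bsub>L\<^esub> w) \<ominus>\<^bsub>L\<^esub> \<phi>\<^bsub>L\<^esub> u \<otimes>\<^bsub>L\<^esub> D w"
    by (simp add: Der_simps gl_bracket_twist ad_def)
  also have "\<dots> = D u \<otimes>\<^bsub>L\<^esub> \<phi>\<^bsub>L\<^esub> w"
    by (simp add: linear_mapD(2)[OF twist_linear] M.minus_eq M.a_ac M.r_neg1 M.r_neg2 M.r_neg)
  finally show "(D \<otimes>\<^bsub>Der K L\<^esub> ad L u) (\<phi>\<^bsub>L\<^esub> w) = ad L (D u) (\<phi>\<^bsub>L\<^esub> w)"
    by (simp add: ad_def)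
qed (simp_all add: Der_simps gl_bracket_def ad_def)

end

section \<open>Extensions, sections and the induced homomorphism\<close>

locale lie_ext =
  fixes K :: "('k, 'm) ring_scheme" and G :: "('k, 'g) hom_lie" and H :: "('k, 'h) hom_lie"
    and E :: "('k, 'g, 'h, 'e) lie_extension"
  assumes ext: "nonabelian_extension K G H E"
begin

lemma incl_morphism: "hom_lie_morphism K H (total_alg E) (incl E)"
  and proj_morphism: "hom_lie_morphism K (total_alg E) G (proj E)"
  and incl_inj: "inj_on (incl E) (carrier H)"
  and proj_surj: "proj E ` carrier (total_alg E) = carrier G"
  and kernel: "incl E ` carrier H = {e \<in> carrier (total_alg E). proj E e = \<zero>\<^bsub>G\<^esub>}"
  using ext by (auto simp: nonabelian_extension_def a_kernel_def')

lemma regular_algebras: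
  "regular_hom_lie_algebra K G" "regular_hom_lie_algebra K H"
  "regular_hom_lie_algebra K (total_alg E)"
  using ext by (auto simp: nonabelian_extension_def)

lemma proj_incl: "u \<in> carrier H \<Longrightarrow> proj E (incl E u) = \<zero>\<^bsub>G\<^esub>"
  using kernel by auto

end

sublocale lie_ext \<subseteq> G: regular_hom_lie_algebra K G
  by (rule regular_algebras)

sublocale lie_ext \<subseteq> hom_lie_ideal K H "total_alg E" "incl E"
proof (intro hom_lie_ideal.intro hom_lie_ideal_axioms.intro regular_algebras incl_morphism incl_inj)
  interpret T: regular_hom_lie_algebra K "total_alg E" by (rule regular_algebras)
  fix e u assume e: "e \<in> carrier (total_alg E)" and u: "u \<in> carrier H"
  then have "proj E (e \<otimes>\<^bsub>total_alg E\<^esub> incl E u) = \<zero>\<^bsub>G\<^esub>" "incl E u \<in> carrier (total_alg E)"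
    using hom_lie_morphismD(2)[OF incl_morphism] hom_lie_morphismD(2,5)[OF proj_morphism]
    by (simp_all add: proj_incl G.bracket_zero_right)
  then show "e \<otimes>\<^bsub>total_alg E\<^esub> incl E u \<in> incl E ` carrier H"
    using e kernel by (simp add: T.bracket_closed)
qed

context lie_ext
begin

lemmas proj_closed = hom_lie_morphismD(2)[OF proj_morphism]
lemmas proj_hom = hom_lie_morphismD(3-)[OF proj_morphism]
lemmas proj_minus =
  linear_map_minus[OF hom_lie_morphismD(1)[OF proj_morphism] T.module_axioms G.module_axioms]

lemma proj_eqE:
  assumes "a \<in> carrier (total_alg E)" "b \<in> carrier (total_alg E)" "proj E a = proj E b"
  obtains u where "u \<in> carrier H" "b = a \<oplus>\<^bsub>total_alg E\<^esub> incl E u"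
proof -
  have "proj E (b \<ominus>\<^bsub>total_alg E\<^esub> a) = \<zero>\<^bsub>G\<^esub>"
    using assms by (simp add: proj_minus proj_closed G.minus_eq_zero_iff)
  then obtain u where "u \<in> carrier H" "b \<ominus>\<^bsub>total_alg E\<^esub> a = incl E u"
    using kernel assms by (metis (mono_tags, lifting) T.minus_closed imageE mem_Collect_eq)
  then show ?thesis
    using that assms T.minus_add_cancel by metis
qed

text \<open>
  The projection maps an invariant complement bijectively onto \<open>G\<close>. The section is the inverse, and
  it respects the operations because elements of the complement are determined by their projection.
\<close>

lemma exists_diagonal_section:
  assumes "diagonal_extension K G H E"
  shows "\<exists>s. diagonal_section K G E s"
proof -
  let ?T = "total_alg E"
  obtain S where S: "submodule S K ?T" "\<phi>\<^bsub>?T\<^esub> ` S \<subseteq> S"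
      "incl E ` carrier H \<inter> S = {\<zero>\<^bsub>?T\<^esub>}" "incl E ` carrier H <+>\<^bsub>?T\<^esub> S = carrier ?T"
    using assms unfolding diagonal_extension_def by blast
  note sub = T.submoduleE[OF S(1)]
  have unique: "a = b" if "a \<in> S" "b \<in> S" "proj E a = proj E b" for a b
  proof -
    have ab: "a \<in> carrier ?T" "b \<in> carrier ?T"
      using sub(1) that by auto
    then have "proj E (a \<ominus>\<^bsub>?T\<^esub> b) = \<zero>\<^bsub>G\<^esub>"
      using that by (simp add: proj_minus proj_closed G.minus_eq_zero_iff)
    then have "a \<ominus>\<^bsub>?T\<^esub> b \<in> incl E ` carrier H"
      using kernel ab by simp
    moreover have "a \<ominus>\<^bsub>?T\<^esub> b \<in> S"
      using that sub by (simp add: T.minus_eq)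
    ultimately show ?thesis
      using S(3) ab by (metis IntI T.minus_eq_zero_iff singletonD)
  qed
  have "\<exists>a\<in>S. proj E a = x" if "x \<in> carrier G" for x
  proof -
    obtain e where e: "e \<in> carrier ?T" "proj E e = x"
      using \<open>x \<in> carrier G\<close> proj_surj by (metis imageE)
    then have "e \<in> incl E ` carrier H <+>\<^bsub>?T\<^esub> S"
      using S(4) by simp
    then obtain u a where ua: "u \<in> carrier H" "a \<in> S" "e = incl E u \<oplus>\<^bsub>?T\<^esub> a"
      by (auto simp: set_add_def')
    then have "a \<in> carrier ?T"
      using sub(1) by auto
    then have "proj E a = x"
      using e ua by (simp add: proj_hom proj_incl i_closed proj_closed)
    then show ?thesis
      using ua by blast
  qed
  then obtain s where s: "\<And>x. x \<in> carrier G \<Longrightarrow> s x \<in> S \<and> proj E (s x) = x"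
    by metis
  have sT: "s x \<in> carrier ?T" if "x \<in> carrier G" for x
    using s[OF that] sub(1) by auto
  have "diagonal_section K G E s"
    unfolding diagonal_section_def linear_map_def
  proof (intro conjI ballI)
    show "s \<in> carrier G \<rightarrow> carrier ?T"
      using sT by blast
    show "proj E (s x) = x" if "x \<in> carrier G" for x
      using s that by blast
    show "s (x \<oplus>\<^bsub>G\<^esub> y) = s x \<oplus>\<^bsub>?T\<^esub> s y" if "x \<in> carrier G" "y \<in> carrier G" for x y
      using s that sub sT by (intro unique) (simp_all add: proj_hom)
    show "s (a \<odot>\<^bsub>G\<^esub> x) = a \<odot>\<^bsub>?T\<^esub> s x" if "a \<in> carrier K" "x \<in> carrier G" for a x
      using s that sub sT by (intro unique) (simp_all add: proj_hom)
    show "\<phi>\<^bsub>?T\<^esub> (s x) = s (\<phi>\<^bsub>G\<^esub> x)" if "x \<in> carrier G" for x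
      using s that S(2) sT by (intro unique) (auto simp add: proj_hom G.twist_closed)
  qed
  then show ?thesis
    by blast
qed

lemma section_action_eq: "section_action H E s x = act (s x)"
  by (simp add: section_action_def ideal_action_def)

end

text \<open>
  The standing situation: \<open>H\<close> has trivial center, and its derivations form a diagonal extension of
  the outer ones by the inner ones.
\<close>

locale outer_extension = H: regular_hom_lie_algebra K H
  for K :: "('k, 'm) ring_scheme" and H :: "('k, 'h) hom_lie" +
  assumes center: "hom_lie_center H = {\<zero>\<^bsub>H\<^esub>}"
    and diagonal: "diagonal_extension K (Out K H) (Inn K H)
           \<lparr>total_alg = Der K H, incl = (\<lambda>D. D), proj = out_proj K H\<rparr>"
begin

lemma der_ext: "lie_ext K (Out K H) (Inn K H)
    \<lparr>total_alg = Der K H, incl = (\<lambda>D. D), proj = out_proj K H\<rparr>"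
  using diagonal by (simp add: lie_ext_def diagonal_extension_def)

lemmas out_proj_morphism = lie_ext.proj_morphism[OF der_ext, simplified]

lemma exists_outer_section:
  "\<exists>t. linear_map K (Out K H) (Der K H) t \<and> (\<forall>x \<in> carrier (Out K H). out_proj K H (t x) = x) \<and>
    (\<forall>x \<in> carrier (Out K H). \<phi>\<^bsub>Der K H\<^esub> (t x) = t (\<phi>\<^bsub>Out K H\<^esub> x))"
  using lie_ext.exists_diagonal_section[OF der_ext diagonal] by (simp add: diagonal_section_def)

end

sublocale outer_extension \<subseteq> Der: regular_hom_lie_algebra K "Der K H"
  using lie_ext.regular_algebras(3)[OF der_ext] by simp

sublocale outer_extension \<subseteq> Out: regular_hom_lie_algebra K "Out K H"
  using lie_ext.regular_algebras(1)[OF der_ext] .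

context outer_extension
begin

abbreviation action :: "('k, 'g, 'h, 'e) lie_extension \<Rightarrow> 'e \<Rightarrow> 'h \<Rightarrow> 'h"
  where "action E \<equiv> ideal_action H (total_alg E) (incl E)"

lemmas ad_closed = hom_lie_morphismD(2)[OF H.ad_morphism]
lemmas ad_hom = hom_lie_morphismD(3-)[OF H.ad_morphism]
lemmas out_proj_closed = hom_lie_morphismD(2)[OF out_proj_morphism]
lemmas out_proj_hom = hom_lie_morphismD(3-)[OF out_proj_morphism]

lemma ad_zero_iff:
  assumes "u \<in> carrier H"
  shows "ad H u = \<zero>\<^bsub>Der K H\<^esub> \<longleftrightarrow> u = \<zero>\<^bsub>H\<^esub>"
proof
  assume ad0: "ad H u = \<zero>\<^bsub>Der K H\<^esub>"
  have "u \<otimes>\<^bsub>H\<^esub> v = \<zero>\<^bsub>H\<^esub>" if "v \<in> carrier H" for v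
    using that fun_cong[OF ad0, of v] by (simp add: Der_simps ad_def)
  then have "u \<in> hom_lie_center H"
    using assms by (simp add: hom_lie_center_def)
  then show "u = \<zero>\<^bsub>H\<^esub>"
    using center by simp
qed (simp add: linear_map_zero[OF hom_lie_morphismD(1)[OF H.ad_morphism] H.module_axioms Der.module_axioms])

lemma ad_inj: "inj_on (ad H) (carrier H)"
  by (rule linear_map_inj_on[OF hom_lie_morphismD(1)[OF H.ad_morphism] H.module_axioms Der.module_axioms])
    (simp add: ad_zero_iff)

lemma out_proj_ad: "u \<in> carrier H \<Longrightarrow> out_proj K H (ad H u) = \<zero>\<^bsub>Out K H\<^esub>"
  using lie_ext.proj_incl[OF der_ext, of "ad H u"] by (simp add: Inn_def)

lemma out_proj_eqE:
  assumes "A \<in> carrier (Der K H)" "B \<in> carrier (Der K H)" "out_proj K H A = out_proj K H B"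
  obtains u where "u \<in> carrier H" "B = A \<oplus>\<^bsub>Der K H\<^esub> ad H u"
proof -
  obtain N where "N \<in> carrier (Inn K H)" "B = A \<oplus>\<^bsub>Der K H\<^esub> N"
    using assms by (rule lie_ext.proj_eqE[OF der_ext, of A B, simplified])
  then show ?thesis
    using that by (auto simp: Inn_def)
qed

text \<open>
  Elements with the same image in \<open>G\<close> differ by an element of \<open>H\<close>, hence act by derivations that
  differ by an inner one. This makes the induced homomorphism independent of the section.
\<close>

lemma out_proj_action_eq:
  assumes "nonabelian_extension K G H E"
    and "a \<in> carrier (total_alg E)" "b \<in> carrier (total_alg E)" "proj E a = proj E b"
  shows "out_proj K H (action E a) = out_proj K H (action E b)"
proof -
  interpret E: lie_ext K G H E by (rule lie_ext.intro) fact
  obtain u where u: "u \<in> carrier H" "b = a \<oplus>\<^bsub>total_alg E\<^esub> incl E u"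
    using assms(2-4) by (rule E.proj_eqE)
  then show ?thesis
    using assms(2) hom_lie_morphismD(2,3)[OF E.act_morphism]
    by (simp add: E.act_i E.i_closed out_proj_hom out_proj_ad ad_closed out_proj_closed)
qed

text \<open>
  An element of \<open>H\<close> that acts on \<open>H\<close> as zero is central, hence zero. So an extension embeds into
  the product of \<open>G\<close> and \<open>Der H\<close>.
\<close>

lemma proj_action_inj:
  assumes "nonabelian_extension K G H E"
    and "a \<in> carrier (total_alg E)" "b \<in> carrier (total_alg E)" "proj E a = proj E b"
    and "action E a = action E b"
  shows "a = b"
proof -
  interpret E: lie_ext K G H E by (rule lie_ext.intro) fact
  obtain u where u: "u \<in> carrier H" "b = a \<oplus>\<^bsub>total_alg E\<^esub> incl E u"
    using assms(2-4) by (rule E.proj_eqE)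
  have "action E a = action E a \<oplus>\<^bsub>Der K H\<^esub> ad H u"
    using u assms(2,5) hom_lie_morphismD(3)[OF E.act_morphism] by (simp add: E.act_i E.i_closed)
  then have "ad H u = \<zero>\<^bsub>Der K H\<^esub>"
    using E.act_derivation[OF assms(2)] ad_closed[OF u(1)] by simp
  then have "u = \<zero>\<^bsub>H\<^esub>"
    using u by (simp add: ad_zero_iff)
  then show ?thesis
    using u(2) assms(2) linear_map_zero[OF hom_lie_morphismD(1)[OF E.i_morphism]
        H.module_axioms E.T.module_axioms] by simp
qed

lemma section_hom_proj:
  assumes "nonabelian_extension K G H E" "diagonal_section K G E s" "e \<in> carrier (total_alg E)"
  shows "section_hom K G H E s (proj E e) = out_proj K H (action E e)"
proof -
  interpret E: lie_ext K G H E by (rule lie_ext.intro) fact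
  have "s (proj E e) \<in> carrier (total_alg E)" "proj E (s (proj E e)) = proj E e"
    using assms E.proj_closed[OF assms(3)] by (auto simp: diagonal_section_def linear_map_def)
  then show ?thesis
    using assms(3) E.proj_closed[OF assms(3)]
    by (simp add: section_hom_def E.section_action_eq
        out_proj_action_eq[OF assms(1), of "s (proj E e)" e])
qed

text \<open>
  The projection is surjective, so an extensional function on \<open>G\<close> is determined by its composite
  with it. The condition on this composite does not mention \<open>s\<close>, so all sections give one function.
\<close>

lemma eq_section_homI:
  assumes "nonabelian_extension K G H E" "diagonal_section K G E s"
    and "f \<in> extensional (carrier G)"
    and "\<And>e. e \<in> carrier (total_alg E) \<Longrightarrow> f (proj E e) = out_proj K H (action E e)"
  shows "f = section_hom K G H E s"
proof (rule extensionalityI[OF assms(3)])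
  interpret E: lie_ext K G H E by (rule lie_ext.intro) fact
  show "section_hom K G H E s \<in> extensional (carrier G)"
    by (simp add: section_hom_def)
  fix x assume "x \<in> carrier G"
  then obtain e where "e \<in> carrier (total_alg E)" "x = proj E e"
    using E.proj_surj by auto
  then show "f x = section_hom K G H E s x"
    using assms(4) section_hom_proj[OF assms(1,2)] by simp
qed

lemma induced_hom_eq_section_hom:
  assumes "nonabelian_extension K G H E" "diagonal_section K G E s"
  shows "induced_hom K G H E = section_hom K G H E s"
  unfolding induced_hom_def
proof (rule the_equality)
  show "f = section_hom K G H E s"
    if f: "\<exists>s. diagonal_section K G E s \<and> f = section_hom K G H E s" for f
  proof (rule eq_section_homI[OF assms])
    show "f \<in> extensional (carrier G)"
      using f by (auto simp: section_hom_def)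
    show "f (proj E e) = out_proj K H (action E e)" if "e \<in> carrier (total_alg E)" for e
      using f section_hom_proj[OF assms(1) _ that] by auto
  qed
qed (use assms in blast)

lemma diagonal_extensionE:
  assumes "diagonal_extension K G H E"
  obtains s where "nonabelian_extension K G H E" "diagonal_section K G E s"
  using that lie_ext.exists_diagonal_section[OF lie_ext.intro assms] assms
  unfolding diagonal_extension_def by blast

lemma induced_hom_proj:
  assumes "diagonal_extension K G H E" "e \<in> carrier (total_alg E)"
  shows "induced_hom K G H E (proj E e) = out_proj K H (action E e)"
proof -
  obtain s where E: "nonabelian_extension K G H E" and s: "diagonal_section K G E s"
    using assms(1) by (rule diagonal_extensionE)
  show ?thesis
    using section_hom_proj[OF E s assms(2)] by (simp add: induced_hom_eq_section_hom[OF E s])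
qed

lemma induced_hom_eqI:
  assumes "diagonal_extension K G H E"
    and "f \<in> extensional (carrier G)"
    and "\<And>e. e \<in> carrier (total_alg E) \<Longrightarrow> f (proj E e) = out_proj K H (action E e)"
  shows "induced_hom K G H E = f"
proof -
  obtain s where E: "nonabelian_extension K G H E" and s: "diagonal_section K G E s"
    using assms(1) by (rule diagonal_extensionE)
  show ?thesis
    using eq_section_homI[OF E s assms(2,3)] by (simp add: induced_hom_eq_section_hom[OF E s])
qed

lemma induced_hom_extensional:
  assumes "diagonal_extension K G H E"
  shows "induced_hom K G H E \<in> extensional (carrier G)"
proof -
  obtain s where E: "nonabelian_extension K G H E" and s: "diagonal_section K G E s"
    using assms(1) by (rule diagonal_extensionE)
  show ?thesis
    by (simp add: induced_hom_eq_section_hom[OF E s] section_hom_def)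
qed

lemma induced_hom_morphism:
  assumes diag: "diagonal_extension K G H E"
  shows "induced_hom K G H E \<in> hom_lie_homs K G (Out K H)"
proof -
  interpret E: lie_ext K G H E
    using diag by (intro lie_ext.intro) (simp add: diagonal_extension_def)
  note ind = induced_hom_proj[OF diag]
  note om = hom_lie_morphism_comp[OF E.act_morphism out_proj_morphism]
  note closed = E.T.bracket_closed E.T.twist_closed E.T.a_closed E.T.smult_closed
  \<comment> \<open>Every operation of \<open>G\<close> is computed on lifts, where the map is a composite of two morphisms.\<close>
  define l where "l = inv_into (carrier (total_alg E)) (proj E)"
  have l: "l x \<in> carrier (total_alg E) \<and> proj E (l x) = x" if "x \<in> carrier G" for x
    using that E.proj_surj by (auto simp: l_def inv_into_into f_inv_into_f)
  have ind_l: "induced_hom K G H E x = out_proj K H (action E (l x))" if "x \<in> carrier G" for x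
    using ind[of "l x"] l[OF that] by simp
  have "hom_lie_morphism K G (Out K H) (induced_hom K G H E)"
  proof (rule hom_lie_morphismI)
    fix x assume x: "x \<in> carrier G"
    show "induced_hom K G H E x \<in> carrier (Out K H)"
      using l[OF x] hom_lie_morphismD(2)[OF om] by (simp add: ind_l x)
    show "induced_hom K G H E (\<phi>\<^bsub>G\<^esub> x) = \<phi>\<^bsub>Out K H\<^esub> (induced_hom K G H E x)"
      using l[OF x] ind[of "\<phi>\<^bsub>total_alg E\<^esub> (l x)"] hom_lie_morphismD(6)[OF om]
      by (simp add: ind_l x closed E.proj_hom)
    show "induced_hom K G H E (a \<odot>\<^bsub>G\<^esub> x) = a \<odot>\<^bsub>Out K H\<^esub> induced_hom K G H E x"
      if "a \<in> carrier K" for a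
      using l[OF x] that ind[of "a \<odot>\<^bsub>total_alg E\<^esub> l x"] hom_lie_morphismD(4)[OF om]
      by (simp add: ind_l x closed E.proj_hom)
    fix y assume y: "y \<in> carrier G"
    show "induced_hom K G H E (x \<oplus>\<^bsub>G\<^esub> y) = induced_hom K G H E x \<oplus>\<^bsub>Out K H\<^esub> induced_hom K G H E y"
      using l[OF x] l[OF y] ind[of "l x \<oplus>\<^bsub>total_alg E\<^esub> l y"] hom_lie_morphismD(3)[OF om]
      by (simp add: ind_l x y closed E.proj_hom)
    show "induced_hom K G H E (x \<otimes>\<^bsub>G\<^esub> y) = induced_hom K G H E x \<otimes>\<^bsub>Out K H\<^esub> induced_hom K G H E y"
      using l[OF x] l[OF y] ind[of "l x \<otimes>\<^bsub>total_alg E\<^esub> l y"] hom_lie_morphismD(5)[OF om]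
      by (simp add: ind_l x y closed E.proj_hom)
  qed
  then show ?thesis
    using induced_hom_extensional[OF diag] by (simp add: hom_lie_homs_def)
qed

section \<open>Extensions are isomorphic when they induce the same homomorphism\<close>

text \<open>
  An isomorphism of extensions intertwines the actions on \<open>H\<close>, hence preserves the induced
  homomorphism.
\<close>

lemma induced_hom_eq_of_isomorphic:
  assumes E1: "diagonal_extension K G H E1" and E2: "diagonal_extension K G H E2"
    and iso: "isomorphic_extensions K H E1 E2"
  shows "induced_hom K G H E1 = induced_hom K G H E2"
proof -
  interpret E1: lie_ext K G H E1
    using E1 by (intro lie_ext.intro) (simp add: diagonal_extension_def)
  interpret E2: lie_ext K G H E2
    using E2 by (intro lie_ext.intro) (simp add: diagonal_extension_def)
  obtain \<theta> where \<theta>: "hom_lie_morphism K (total_alg E2) (total_alg E1) \<theta>"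
      "\<And>u. u \<in> carrier H \<Longrightarrow> \<theta> (incl E2 u) = incl E1 u"
      "\<And>e. e \<in> carrier (total_alg E2) \<Longrightarrow> proj E1 (\<theta> e) = proj E2 e"
    using iso unfolding isomorphic_extensions_def by blast
  have act: "action E1 (\<theta> e) = action E2 e" if e: "e \<in> carrier (total_alg E2)" for e
  proof (rule extensionalityI[OF E1.act_extensional E2.act_extensional])
    fix u assume u: "u \<in> carrier H"
    have "incl E1 (action E2 e u) = \<theta> (incl E2 (action E2 e u))"
      using \<theta>(2) E2.act_closed e u by simp
    also have "\<dots> = \<theta> e \<otimes>\<^bsub>total_alg E1\<^esub> incl E1 u"
      using e u \<theta>(2) hom_lie_morphismD(5)[OF \<theta>(1)] by (simp add: E2.i_act E2.i_closed)
    finally show "action E1 (\<theta> e) u = action E2 e u"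
      using e u hom_lie_morphismD(2)[OF \<theta>(1)] E2.act_closed by (intro E1.act_eqI) simp_all
  qed
  have "induced_hom K G H E2 = induced_hom K G H E1"
  proof (rule induced_hom_eqI[OF E2 induced_hom_extensional[OF E1]])
    fix e assume e: "e \<in> carrier (total_alg E2)"
    show "induced_hom K G H E1 (proj E2 e) = out_proj K H (action E2 e)"
      using induced_hom_proj[OF E1 hom_lie_morphismD(2)[OF \<theta>(1) e]] e by (simp add: \<theta>(3) act)
  qed
  then show ?thesis ..
qed

text \<open>
  Conversely, both extensions embed into the product of \<open>G\<close> and \<open>Der H\<close>, and the induced
  homomorphism determines the image, a fibre product over \<open>Out H\<close>. The isomorphism matches
  elements with the same image.
\<close>

lemma isomorphic_of_induced_hom_eq:
  assumes E1: "diagonal_extension K G H E1" and E2: "diagonal_extension K G H E2"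
    and eq: "induced_hom K G H E1 = induced_hom K G H E2"
  shows "isomorphic_extensions K H E1 E2"
proof -
  have n1: "nonabelian_extension K G H E1" and n2: "nonabelian_extension K G H E2"
    using E1 E2 by (simp_all add: diagonal_extension_def)
  interpret E1: lie_ext K G H E1 by (rule lie_ext.intro) fact
  interpret E2: lie_ext K G H E2 by (rule lie_ext.intro) fact
  have "\<exists>a. a \<in> carrier (total_alg E1) \<and> proj E1 a = proj E2 b \<and> action E1 a = action E2 b"
    if b: "b \<in> carrier (total_alg E2)" for b
  proof -
    obtain c where c: "c \<in> carrier (total_alg E1)" "proj E1 c = proj E2 b"
      using E1.proj_surj E2.proj_closed[OF b] by (metis imageE)
    \<comment> \<open>Any lift \<open>c\<close> acts like \<open>b\<close> up to an inner derivation; its element \<open>u\<close> corrects the lift.\<close>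
    have "out_proj K H (action E1 c) = out_proj K H (action E2 b)"
      using induced_hom_proj[OF E1 c(1)] induced_hom_proj[OF E2 b] eq c(2) by simp
    then obtain u where u: "u \<in> carrier H" "action E2 b = action E1 c \<oplus>\<^bsub>Der K H\<^esub> ad H u"
      using E1.act_derivation[OF c(1)] E2.act_derivation[OF b] by (blast elim: out_proj_eqE)
    have "proj E1 (c \<oplus>\<^bsub>total_alg E1\<^esub> incl E1 u) = proj E2 b"
      using c u by (simp add: E1.proj_hom E1.i_closed E1.proj_incl E2.proj_closed[OF b])
    moreover have "action E1 (c \<oplus>\<^bsub>total_alg E1\<^esub> incl E1 u) = action E2 b"
      using c u hom_lie_morphismD(3)[OF E1.act_morphism] by (simp add: E1.i_closed E1.act_i)
    ultimately show ?thesis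
      using c(1) E1.i_closed[OF u(1)] E1.T.a_closed by blast
  qed
  then obtain \<theta> where \<theta>: "\<And>b. b \<in> carrier (total_alg E2) \<Longrightarrow> \<theta> b \<in> carrier (total_alg E1) \<and>
      proj E1 (\<theta> b) = proj E2 b \<and> action E1 (\<theta> b) = action E2 b"
    by metis
  have "hom_lie_morphism K (total_alg E2) (total_alg E1) \<theta>"
    by (rule hom_lie_morphism_by_joint_embedding[OF E1.T.hom_lie_algebra_axioms
          E2.T.hom_lie_algebra_axioms E1.proj_morphism E1.act_morphism proj_action_inj[OF n1]
          E2.proj_morphism E2.act_morphism]) (simp_all add: \<theta>)
  moreover have "\<theta> (incl E2 u) = incl E1 u" if u: "u \<in> carrier H" for u
    using \<theta>[OF E2.i_closed[OF u]] u
    by (intro proj_action_inj[OF n1])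
      (simp_all add: E1.i_closed E1.proj_incl E2.proj_incl E1.act_i E2.act_i)
  ultimately show ?thesis
    using \<theta> unfolding isomorphic_extensions_def by blast
qed

end

section \<open>Every homomorphism to the outer derivations is induced\<close>

text \<open>
  A linear section \<open>t\<close> of \<open>Der H \<rightarrow> Out H\<close> identifies \<open>G \<times> H\<close> with the fibre product of \<open>G\<close> and
  \<open>Der H\<close> over \<open>Out H\<close>, by sending \<open>(x, u)\<close> to \<open>x\<close> and the following derivation.
\<close>

definition fibre_der ::
    "('k, 'm) ring_scheme \<Rightarrow> ('k, 'h) hom_lie \<Rightarrow> ('g \<Rightarrow> ('h \<Rightarrow> 'h) set) \<Rightarrow>
      (('h \<Rightarrow> 'h) set \<Rightarrow> 'h \<Rightarrow> 'h) \<Rightarrow> 'g \<times> 'h \<Rightarrow> 'h \<Rightarrow> 'h"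
  where "fibre_der K H f t a = t (f (fst a)) \<oplus>\<^bsub>Der K H\<^esub> ad H (snd a)"

text \<open>
  The structure of the fibre product in these coordinates. Only the bracket is not componentwise:
  its second entry is what remains of the bracket of derivations after its part in the image
  of \<open>t\<close> is removed.
\<close>

definition fibre_alg ::
    "('k, 'm) ring_scheme \<Rightarrow> ('k, 'g) hom_lie \<Rightarrow> ('k, 'h) hom_lie \<Rightarrow> ('g \<Rightarrow> ('h \<Rightarrow> 'h) set) \<Rightarrow>
      (('h \<Rightarrow> 'h) set \<Rightarrow> 'h \<Rightarrow> 'h) \<Rightarrow> ('k, 'g \<times> 'h) hom_lie"
  where "fibre_alg K G H f t =
    \<lparr>carrier = carrier G \<times> carrier H,
     monoid.mult = (\<lambda>a b. (fst a \<otimes>\<^bsub>G\<^esub> fst b,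
       inv_into (carrier H) (ad H) (fibre_der K H f t a \<otimes>\<^bsub>Der K H\<^esub> fibre_der K H f t b
         \<ominus>\<^bsub>Der K H\<^esub> t (f (fst a \<otimes>\<^bsub>G\<^esub> fst b))))),
     one = undefined,
     zero = (\<zero>\<^bsub>G\<^esub>, \<zero>\<^bsub>H\<^esub>),
     add = (\<lambda>a b. (fst a \<oplus>\<^bsub>G\<^esub> fst b, snd a \<oplus>\<^bsub>H\<^esub> snd b)),
     smult = (\<lambda>c a. (c \<odot>\<^bsub>G\<^esub> fst a, c \<odot>\<^bsub>H\<^esub> snd a)),
     twist = map_prod \<phi>\<^bsub>G\<^esub> \<phi>\<^bsub>H\<^esub>\<rparr>"

definition fibre_extension ::
    "('k, 'm) ring_scheme \<Rightarrow> ('k, 'g) hom_lie \<Rightarrow> ('k, 'h) hom_lie \<Rightarrow> ('g \<Rightarrow> ('h \<Rightarrow> 'h) set) \<Rightarrow>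
      (('h \<Rightarrow> 'h) set \<Rightarrow> 'h \<Rightarrow> 'h) \<Rightarrow> ('k, 'g, 'h, 'g \<times> 'h) lie_extension"
  where "fibre_extension K G H f t =
    \<lparr>total_alg = fibre_alg K G H f t, incl = (\<lambda>u. (\<zero>\<^bsub>G\<^esub>, u)), proj = fst\<rparr>"

locale outer_pullback = outer_extension K H + G: regular_hom_lie_algebra K G
  for K :: "('k, 'm) ring_scheme" and H :: "('k, 'h) hom_lie" and G :: "('k, 'g) hom_lie" +
  fixes f :: "'g \<Rightarrow> ('h \<Rightarrow> 'h) set" and t :: "('h \<Rightarrow> 'h) set \<Rightarrow> 'h \<Rightarrow> 'h"
  assumes f_morphism: "hom_lie_morphism K G (Out K H) f"
    and t_linear: "linear_map K (Out K H) (Der K H) t"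
    and out_proj_t: "x \<in> carrier (Out K H) \<Longrightarrow> out_proj K H (t x) = x"
    and t_twist: "x \<in> carrier (Out K H) \<Longrightarrow> \<phi>\<^bsub>Der K H\<^esub> (t x) = t (\<phi>\<^bsub>Out K H\<^esub> x)"
begin

abbreviation "D \<equiv> fibre_der K H f t"
abbreviation "P \<equiv> fibre_alg K G H f t"
abbreviation "Ext \<equiv> fibre_extension K G H f t"

lemmas f_closed = hom_lie_morphismD(2)[OF f_morphism]
lemmas f_hom = hom_lie_morphismD(3-)[OF f_morphism]
lemmas t_closed = linear_mapD(1)[OF t_linear]
lemmas t_hom = linear_mapD(2,3)[OF t_linear]

lemma fibre_alg_simps:
  "carrier P = carrier G \<times> carrier H"
  "\<zero>\<^bsub>P\<^esub> = (\<zero>\<^bsub>G\<^esub>, \<zero>\<^bsub>H\<^esub>)"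
  "a \<oplus>\<^bsub>P\<^esub> b = (fst a \<oplus>\<^bsub>G\<^esub> fst b, snd a \<oplus>\<^bsub>H\<^esub> snd b)"
  "c \<odot>\<^bsub>P\<^esub> a = (c \<odot>\<^bsub>G\<^esub> fst a, c \<odot>\<^bsub>H\<^esub> snd a)"
  "\<phi>\<^bsub>P\<^esub> = map_prod \<phi>\<^bsub>G\<^esub> \<phi>\<^bsub>H\<^esub>"
  by (simp_all add: fibre_alg_def)

lemma fibre_extension_simps: "total_alg Ext = P" "incl Ext u = (\<zero>\<^bsub>G\<^esub>, u)" "proj Ext = fst"
  by (simp_all add: fibre_extension_def)

lemma D_closed: "a \<in> carrier P \<Longrightarrow> D a \<in> carrier (Der K H)"
  by (auto simp: fibre_alg_simps fibre_der_def ad_closed t_closed f_closed)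

lemma out_proj_D: "a \<in> carrier P \<Longrightarrow> out_proj K H (D a) = f (fst a)"
  by (auto simp: fibre_alg_simps fibre_der_def ad_closed t_closed f_closed out_proj_hom(1)
      out_proj_t out_proj_ad)

lemma D_inj:
  assumes "a \<in> carrier P" "b \<in> carrier P" "fst a = fst b" "D a = D b"
  shows "a = b"
proof -
  have "ad H (snd a) = ad H (snd b)"
    using assms by (auto simp: fibre_alg_simps fibre_der_def ad_closed t_closed f_closed)
  then show ?thesis
    using assms ad_inj by (auto simp: fibre_alg_simps dest: inj_onD intro: prod_eqI)
qed

lemma D_incl: "u \<in> carrier H \<Longrightarrow> D (\<zero>\<^bsub>G\<^esub>, u) = ad H u"
  using linear_map_zero[OF hom_lie_morphismD(1)[OF f_morphism] G.module_axioms Out.module_axioms]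
    linear_map_zero[OF t_linear Out.module_axioms Der.module_axioms]
  by (simp add: fibre_der_def ad_closed)

text \<open>The coordinates reach every point of the fibre product.\<close>

lemma D_coordinate:
  assumes x: "x \<in> carrier G" and A: "A \<in> carrier (Der K H)" "out_proj K H A = f x"
  shows "inv_into (carrier H) (ad H) (A \<ominus>\<^bsub>Der K H\<^esub> t (f x)) \<in> carrier H"
    and "D (x, inv_into (carrier H) (ad H) (A \<ominus>\<^bsub>Der K H\<^esub> t (f x))) = A"
proof -
  have tx: "t (f x) \<in> carrier (Der K H)" "out_proj K H (t (f x)) = out_proj K H A"
    using assms by (simp_all add: t_closed f_closed out_proj_t)
  obtain u where u: "u \<in> carrier H" "A = t (f x) \<oplus>\<^bsub>Der K H\<^esub> ad H u"
    using out_proj_eqE[OF tx(1) A(1) tx(2)] by blast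
  have "A \<ominus>\<^bsub>Der K H\<^esub> t (f x) = ad H u"
    using tx(1) ad_closed[OF u(1)] Der.M.a_comm[of "t (f x)" "ad H u"]
    by (simp add: u(2) Der.M.minus_eq Der.M.a_assoc Der.M.r_neg)
  then have "inv_into (carrier H) (ad H) (A \<ominus>\<^bsub>Der K H\<^esub> t (f x)) = u"
    using u(1) ad_inj by (simp add: inv_into_f_f)
  then show "inv_into (carrier H) (ad H) (A \<ominus>\<^bsub>Der K H\<^esub> t (f x)) \<in> carrier H"
    and "D (x, inv_into (carrier H) (ad H) (A \<ominus>\<^bsub>Der K H\<^esub> t (f x))) = A"
    using u by (simp_all add: fibre_der_def)
qed

text \<open>
  The fibre product is closed under the bracket because \<open>out_proj\<close> and \<open>f\<close> are multiplicative.
\<close>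

lemma fibre_bracket:
  assumes a: "a \<in> carrier P" and b: "b \<in> carrier P"
  shows "a \<otimes>\<^bsub>P\<^esub> b \<in> carrier P" "fst (a \<otimes>\<^bsub>P\<^esub> b) = fst a \<otimes>\<^bsub>G\<^esub> fst b"
    and "D (a \<otimes>\<^bsub>P\<^esub> b) = D a \<otimes>\<^bsub>Der K H\<^esub> D b"
proof -
  have ab: "fst a \<in> carrier G" "fst b \<in> carrier G"
    using a b by (auto simp: fibre_alg_simps)
  have "out_proj K H (D a \<otimes>\<^bsub>Der K H\<^esub> D b) = f (fst a \<otimes>\<^bsub>G\<^esub> fst b)"
    using a b ab by (simp add: out_proj_hom(3) D_closed out_proj_D f_hom(3))
  note coord = D_coordinate[OF G.bracket_closed[OF ab]
      Der.bracket_closed[OF D_closed[OF a] D_closed[OF b]] this]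
  have P: "a \<otimes>\<^bsub>P\<^esub> b = (fst a \<otimes>\<^bsub>G\<^esub> fst b, inv_into (carrier H) (ad H)
      (D a \<otimes>\<^bsub>Der K H\<^esub> D b \<ominus>\<^bsub>Der K H\<^esub> t (f (fst a \<otimes>\<^bsub>G\<^esub> fst b))))"
    by (simp add: fibre_alg_def)
  show "a \<otimes>\<^bsub>P\<^esub> b \<in> carrier P" "fst (a \<otimes>\<^bsub>P\<^esub> b) = fst a \<otimes>\<^bsub>G\<^esub> fst b"
    using coord(1) ab by (simp_all add: P fibre_alg_simps G.bracket_closed)
  show "D (a \<otimes>\<^bsub>P\<^esub> b) = D a \<otimes>\<^bsub>Der K H\<^esub> D b"
    unfolding P by (rule coord(2))
qed

lemma fst_morphism: "hom_lie_morphism K P G fst"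
  by (intro hom_lie_morphismI fibre_bracket(2)) (auto simp: fibre_alg_simps)

lemma D_morphism: "hom_lie_morphism K P (Der K H) D"
proof (intro hom_lie_morphismI D_closed fibre_bracket(3))
  fix a assume "a \<in> carrier P"
  then obtain x u where a: "a = (x, u)" "x \<in> carrier G" "u \<in> carrier H"
    by (auto simp: fibre_alg_simps)
  show "D (\<phi>\<^bsub>P\<^esub> a) = \<phi>\<^bsub>Der K H\<^esub> (D a)"
    using a(2,3) unfolding a(1) by (simp add: fibre_alg_simps fibre_der_def f_hom(4) ad_hom(4)
        linear_mapD(2)[OF Der.twist_linear] t_closed f_closed ad_closed t_twist)
  show "D (c \<odot>\<^bsub>P\<^esub> a) = c \<odot>\<^bsub>Der K H\<^esub> D a" if "c \<in> carrier K" for c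
    using a(2,3) that unfolding a(1) by (simp add: fibre_alg_simps fibre_der_def f_hom(2) ad_hom(2)
        t_hom t_closed f_closed ad_closed Der.smult_r_distr)
  fix b assume "b \<in> carrier P"
  then obtain y v where b: "b = (y, v)" "y \<in> carrier G" "v \<in> carrier H"
    by (auto simp: fibre_alg_simps)
  show "D (a \<oplus>\<^bsub>P\<^esub> b) = D a \<oplus>\<^bsub>Der K H\<^esub> D b"
    using a(2,3) b(2,3) unfolding a(1) b(1) by (simp add: fibre_alg_simps fibre_der_def f_hom(1)
        ad_hom(1) t_hom t_closed f_closed ad_closed Der.M.a_ac)
qed

lemma fibre_alg_regular: "regular_hom_lie_algebra K P"
proof (intro regular_hom_lie_algebra.intro regular_hom_lie_algebra_axioms.intro)
  show "hom_lie_algebra K P"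
  proof (rule hom_lie_algebra_by_joint_embedding[OF G.hom_lie_algebra_axioms
        Der.hom_lie_algebra_axioms fst_morphism D_morphism _ _ D_inj])
    show "D \<zero>\<^bsub>P\<^esub> = \<zero>\<^bsub>Der K H\<^esub>"
      by (simp add: fibre_alg_simps(2) D_incl ad_zero_iff)
  qed (simp_all add: fibre_bracket(1), auto simp: fibre_alg_simps G.twist_closed H.twist_closed)
  show "bij_betw \<phi>\<^bsub>P\<^esub> (carrier P) (carrier P)"
    using G.twist_bij H.twist_bij
    by (auto simp: fibre_alg_simps bij_betw_def map_prod_inj_on map_prod_surj_on)
qed

lemma incl_morphism: "hom_lie_morphism K H P (incl Ext)"
proof (rule hom_lie_morphismI)
  fix u v assume uv: "u \<in> carrier H" "v \<in> carrier H"
  then have c: "(\<zero>\<^bsub>G\<^esub>, u) \<in> carrier P" "(\<zero>\<^bsub>G\<^esub>, v) \<in> carrier P" "(\<zero>\<^bsub>G\<^esub>, u \<otimes>\<^bsub>H\<^esub> v) \<in> carrier P"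
    by (simp_all add: fibre_alg_simps H.bracket_closed)
  show "incl Ext (u \<otimes>\<^bsub>H\<^esub> v) = incl Ext u \<otimes>\<^bsub>P\<^esub> incl Ext v"
    unfolding fibre_extension_simps
    by (rule D_inj) (simp_all add: c fibre_bracket D_incl uv H.bracket_closed ad_hom(3)
        G.bracket_zero_right)
qed (auto simp: fibre_extension_simps fibre_alg_simps
    linear_map_zero[OF G.twist_linear G.module_axioms G.module_axioms])

lemma fibre_nonabelian: "nonabelian_extension K G H Ext"
proof -
  have "incl Ext ` carrier H = a_kernel P G fst"
    by (auto simp: a_kernel_def' fibre_extension_simps fibre_alg_simps)
  moreover have "fst ` carrier P = carrier G"
    using H.zero_closed by (auto simp: fibre_alg_simps intro!: image_eqI[of _ fst "(_, \<zero>\<^bsub>H\<^esub>)"])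
  moreover have "inj_on (incl Ext) (carrier H)"
    by (auto simp: fibre_extension_simps intro: inj_onI)
  ultimately show ?thesis
    using fibre_alg_regular fst_morphism incl_morphism
    by (simp add: nonabelian_extension_def fibre_extension_simps
        G.regular_hom_lie_algebra_axioms H.regular_hom_lie_algebra_axioms)
qed

lemma fibre_diagonal: "diagonal_extension K G H Ext"
proof -
  interpret P: regular_hom_lie_algebra K P by (rule fibre_alg_regular)
  \<comment> \<open>In the fibre product this is the set of pairs \<open>(x, t (f x))\<close>.\<close>
  let ?S = "carrier G \<times> {\<zero>\<^bsub>H\<^esub>}"
  have sub: "?S \<subseteq> carrier P"
    by (auto simp: fibre_alg_simps)
  have smult: "c \<odot>\<^bsub>P\<^esub> a \<in> ?S" if "c \<in> carrier K" "a \<in> ?S" for c a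
    using that by (auto simp: fibre_alg_simps)
  have "submodule ?S K P"
  proof (rule P.submoduleI[OF sub])
    show "\<ominus>\<^bsub>P\<^esub> a \<in> ?S" if "a \<in> ?S" for a
      using smult[OF _ that, of "\<ominus>\<^bsub>K\<^esub> \<one>\<^bsub>K\<^esub>"] that sub by (simp add: P.smult_l_minus subsetD)
  qed (use smult in \<open>auto simp: fibre_alg_simps\<close>)
  moreover have "\<phi>\<^bsub>P\<^esub> ` ?S \<subseteq> ?S"
    by (auto simp: fibre_alg_simps G.twist_closed
        linear_map_zero[OF H.twist_linear H.module_axioms H.module_axioms])
  moreover have "incl Ext ` carrier H \<inter> ?S = {\<zero>\<^bsub>P\<^esub>}"
    by (auto simp: fibre_extension_simps fibre_alg_simps)
  moreover have "incl Ext ` carrier H <+>\<^bsub>P\<^esub> ?S = carrier P"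
  proof
    show "carrier P \<subseteq> incl Ext ` carrier H <+>\<^bsub>P\<^esub> ?S"
    proof
      fix a assume "a \<in> carrier P"
      then have "a = incl Ext (snd a) \<oplus>\<^bsub>P\<^esub> (fst a, \<zero>\<^bsub>H\<^esub>)" "snd a \<in> carrier H" "(fst a, \<zero>\<^bsub>H\<^esub>) \<in> ?S"
        by (auto simp: fibre_extension_simps fibre_alg_simps)
      then show "a \<in> incl Ext ` carrier H <+>\<^bsub>P\<^esub> ?S"
        unfolding set_add_def' by blast
    qed
  qed (auto simp: set_add_def' fibre_extension_simps fibre_alg_simps)
  ultimately show ?thesis
    using fibre_nonabelian by (auto simp: diagonal_extension_def fibre_extension_simps(1))
qed

text \<open>
  Bracketing \<open>D a\<close> with the inner derivation of \<open>u\<close> gives the inner derivation of \<open>D a u\<close>. Hence an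
  element of the fibre product acts on \<open>H\<close> by its own second component.
\<close>

lemma fibre_action:
  assumes a: "a \<in> carrier P"
  shows "action Ext a = D a"
proof -
  interpret X: lie_ext K G H Ext by (rule lie_ext.intro[OF fibre_nonabelian])
  show ?thesis
  proof (rule extensionalityI[OF X.act_extensional])
    show "D a \<in> extensional (carrier H)"
      using D_closed[OF a] by (simp add: Der_simps)
    fix u assume u: "u \<in> carrier H"
    note Du = H.Der_apply_closed[OF D_closed[OF a] u]
    have c: "(\<zero>\<^bsub>G\<^esub>, u) \<in> carrier P" "(\<zero>\<^bsub>G\<^esub>, D a u) \<in> carrier P" "fst a \<in> carrier G"
      using a u Du by (auto simp: fibre_alg_simps)
    have "(\<zero>\<^bsub>G\<^esub>, D a u) = a \<otimes>\<^bsub>P\<^esub> (\<zero>\<^bsub>G\<^esub>, u)"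
      by (rule D_inj) (simp_all add: a c u Du fibre_bracket D_incl G.bracket_zero_right
          H.Der_bracket_ad[OF D_closed])
    then show "action Ext a u = D a u"
      using a u Du by (intro X.act_eqI) (simp_all add: fibre_extension_simps)
  qed
qed

lemma induced_hom_fibre_extension:
  assumes "f \<in> extensional (carrier G)"
  shows "induced_hom K G H Ext = f"
proof (rule induced_hom_eqI[OF fibre_diagonal assms])
  fix a assume "a \<in> carrier (total_alg Ext)"
  then have "a \<in> carrier P"
    by (simp add: fibre_extension_simps(1))
  then show "f (proj Ext a) = out_proj K H (action Ext a)"
    unfolding fibre_action[OF \<open>a \<in> carrier P\<close>] by (simp add: fibre_extension_simps(3) out_proj_D)
qed

end

lemma (in outer_extension) exists_extension_inducing:
  fixes G :: "('k, 'g) hom_lie"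
  assumes "regular_hom_lie_algebra K G" and f: "f \<in> hom_lie_homs K G (Out K H)"
  obtains E :: "('k, 'g, 'h, 'g \<times> 'h) lie_extension"
  where "diagonal_extension K G H E" "induced_hom K G H E = f"
proof -
  interpret G: regular_hom_lie_algebra K G by fact
  obtain t where t: "linear_map K (Out K H) (Der K H) t"
      "\<forall>x \<in> carrier (Out K H). out_proj K H (t x) = x"
      "\<forall>x \<in> carrier (Out K H). \<phi>\<^bsub>Der K H\<^esub> (t x) = t (\<phi>\<^bsub>Out K H\<^esub> x)"
    using exists_outer_section by blast
  interpret outer_pullback K H G f t
    using f t by (intro outer_pullback.intro outer_pullback_axioms.intro outer_extension_axioms
        G.regular_hom_lie_algebra_axioms) (simp_all add: hom_lie_homs_def)
  show ?thesis
    using that[OF fibre_diagonal induced_hom_fibre_extension] f by (simp add: hom_lie_homs_def)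
qed

lemma bij_betw_quotient_kernel:
  assumes "r = {(x, y) \<in> A \<times> A. F x = F y}" and "F ` A = B"
  shows "equiv A r" "F respects r" "bij_betw (\<lambda>C. the_elem (F ` C)) (A // r) B"
proof -
  show equiv: "equiv A r"
    unfolding assms(1) by (intro equivI refl_onI symI transI) auto
  show "F respects r"
    unfolding assms(1) by (auto simp: congruent_def)
  have cls: "the_elem (F ` (r `` {x})) = F x" if "x \<in> A" for x
  proof -
    have "F ` (r `` {x}) = {F x}"
      using that unfolding assms(1) by auto
    then show ?thesis
      by simp
  qed
  show "bij_betw (\<lambda>C. the_elem (F ` C)) (A // r) B"
    unfolding bij_betw_def
  proof
    show "inj_on (\<lambda>C. the_elem (F ` C)) (A // r)"
    proof (rule inj_onI)
      fix C C' assume C: "C \<in> A // r" "C' \<in> A // r" "the_elem (F ` C) = the_elem (F ` C')"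
      obtain x y where xy: "C = r `` {x}" "x \<in> A" "C' = r `` {y}" "y \<in> A"
        using C(1,2) by (elim quotientE) blast
      then have "(x, y) \<in> r"
        using C(3) cls unfolding assms(1) by simp
      then show "C = C'"
        unfolding xy by (rule equiv_class_eq[OF equiv])
    qed
    have "(\<lambda>C. the_elem (F ` C)) ` (A // r) = F ` A"
      using cls by (auto simp: quotient_def image_iff)
    then show "(\<lambda>C. the_elem (F ` C)) ` (A // r) = B"
      using assms(2) by simp
  qed
qed

theorem theorem3p1:
  fixes K :: "('k, 'm) ring_scheme"
    and G :: "('k, 'g) hom_lie"
    and H :: "('k, 'h) hom_lie"
  assumes "algebraically_closed K"
    and "\<forall>n::nat. n > 0 \<longrightarrow> [n] \<cdot>\<^bsub>K\<^esub> \<one>\<^bsub>K\<^esub> \<noteq> \<zero>\<^bsub>K\<^esub>"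
    and "regular_hom_lie_algebra K G"
    and "regular_hom_lie_algebra K H"
    and "hom_lie_center H = {\<zero>\<^bsub>H\<^esub>}"
    and "diagonal_extension K (Out K H) (Inn K H)
           \<lparr>total_alg = Der K H, incl = (\<lambda>D. D), proj = out_proj K H\<rparr>"
  shows
    "equiv (diagonal_extensions K G H :: ('k, 'g, 'h, 'g \<times> 'h) lie_extension set)
       (extension_iso_rel K G H)
     \<and> induced_hom K G H respects
         (extension_iso_rel K G H :: (('k, 'g, 'h, 'g \<times> 'h) lie_extension \<times> _) set)
     \<and> bij_betw (\<lambda>C. the_elem (induced_hom K G H ` C))
         ((diagonal_extensions K G H :: ('k, 'g, 'h, 'g \<times> 'h) lie_extension set)
           // extension_iso_rel K G H)
         (hom_lie_homs K G (Out K H))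
     \<and> (\<forall>E :: ('k, 'g, 'h, 'e) lie_extension. diagonal_extension K G H E \<longrightarrow>
          (\<forall>s. diagonal_section K G E s \<longrightarrow> induced_hom K G H E = section_hom K G H E s) \<and>
          (\<exists>E' :: ('k, 'g, 'h, 'g \<times> 'h) lie_extension. diagonal_extension K G H E' \<and>
             isomorphic_extensions K H E E' \<and> induced_hom K G H E = induced_hom K G H E'))"
proof -
  interpret outer_extension K H
    using assms(4-6) by (intro outer_extension.intro outer_extension_axioms.intro)
  have rel: "(extension_iso_rel K G H :: (('k, 'g, 'h, 'g \<times> 'h) lie_extension \<times> _) set) =
      {(E1, E2) \<in> diagonal_extensions K G H \<times> diagonal_extensions K G H.
        induced_hom K G H E1 = induced_hom K G H E2}"
    unfolding extension_iso_rel_def diagonal_extensions_def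
    using isomorphic_of_induced_hom_eq induced_hom_eq_of_isomorphic by blast
  have image: "induced_hom K G H ` (diagonal_extensions K G H ::
      ('k, 'g, 'h, 'g \<times> 'h) lie_extension set) = hom_lie_homs K G (Out K H)"
  proof
    show "hom_lie_homs K G (Out K H) \<subseteq> induced_hom K G H ` (diagonal_extensions K G H ::
        ('k, 'g, 'h, 'g \<times> 'h) lie_extension set)"
    proof
      fix f assume "f \<in> hom_lie_homs K G (Out K H)"
      then obtain E :: "('k, 'g, 'h, 'g \<times> 'h) lie_extension"
        where "diagonal_extension K G H E" "induced_hom K G H E = f"
        using exists_extension_inducing[OF assms(3)] by blast
      then show "f \<in> induced_hom K G H ` (diagonal_extensions K G H ::
          ('k, 'g, 'h, 'g \<times> 'h) lie_extension set)"
        by (auto simp: diagonal_extensions_def)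
    qed
  qed (auto simp: diagonal_extensions_def induced_hom_morphism)
  have "(\<forall>s. diagonal_section K G E s \<longrightarrow> induced_hom K G H E = section_hom K G H E s) \<and>
      (\<exists>E' :: ('k, 'g, 'h, 'g \<times> 'h) lie_extension. diagonal_extension K G H E' \<and>
        isomorphic_extensions K H E E' \<and> induced_hom K G H E = induced_hom K G H E')"
    if E: "diagonal_extension K G H E" for E :: "('k, 'g, 'h, 'e) lie_extension"
  proof
    have "nonabelian_extension K G H E"
      using E by (simp add: diagonal_extension_def)
    then show "\<forall>s. diagonal_section K G E s \<longrightarrow> induced_hom K G H E = section_hom K G H E s"
      using induced_hom_eq_section_hom by blast
    obtain E' :: "('k, 'g, 'h, 'g \<times> 'h) lie_extension"
      where E': "diagonal_extension K G H E'" "induced_hom K G H E' = induced_hom K G H E"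
      using exists_extension_inducing[OF assms(3) induced_hom_morphism[OF E]] by blast
    then show "\<exists>E' :: ('k, 'g, 'h, 'g \<times> 'h) lie_extension. diagonal_extension K G H E' \<and>
        isomorphic_extensions K H E E' \<and> induced_hom K G H E = induced_hom K G H E'"
      using isomorphic_of_induced_hom_eq[OF E E'(1)] by auto
  qed
  then show ?thesis
    using bij_betw_quotient_kernel[OF rel image] by blast
qed

end
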